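(* Let $\mathcal{H}\in C^1(\mathbb{S}^n)$. Fix $v\in\mathbb{S}^n$ and a two-dimensional linear subspace $\Pi\equiv\mathbb{R}^2$ in $\mathbb{R}^{n+1}$ with $v\in\Pi$. Then, there exists a unique (up to translation) complete regular curve $\alpha=\alpha_v$ in $\mathbb{R}^2$ with the following properties: 1. $\Sigma_{v,\Pi}:=\alpha\times\mathbb{R}^{n-1}$ is a (complete, flat) $\mathcal{H}$-hypersurface in $\mathbb{R}^{n+1}$. 2. $v$ is tangent to $\Sigma_{v,\Pi}$ at some point. Conversely, any complete flat $\mathcal{H}$-hypersurface in $\mathbb{R}^{n+1}$ is one of the examples $\Sigma_{v,\Pi}$.
   Context: Given $\mathcal{H}\in C^1(\mathbb{S}^n)$, an immersed oriented hypersurface $\Sigma$ in $\mathbb{R}^{n+1}$ with Gauss map (unit normal) $\eta:\Sigma\to\mathbb{S}^n$ is called an $\mathcal{H}$-hypersurface if its mean curvature function satisfies $H_\Sigma=\mathcal{H}\circ\eta$. The convention for the mean curvature is that the unit sphere in $\mathbb{R}^{n+1}$ with its inner orientation has mean curvature $1$. A complete flat $\mathcal{H}$-hypersurface is one of the form $\alpha\times\mathbb{R}^{n-1}$, where $\alpha$ is a complete regular curve (not necessarily closed) in a two-dimensional plane $\Pi\equiv\mathbb{R}^2\subset\mathbb{R}^{n+1}$, and $\mathbb{R}^{n-1}$ denotes the orthogonal complement $\Pi^\perp$.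
   Formalization: "v is tangent to Σ at some point" is taken in the oriented sense: v is tangent at a point where the unit normal is v turned by a quarter turn in the oriented plane Π; without this, uniqueness fails, e.g. for H(x) = 1 − ⟨x, Jv⟩, where J is the quarter turn. *)

theory Defs
  imports "HOL-Analysis.Analysis"
begin

section \<open>Maps of class $C^1$ and $C^2$\<close>

text \<open>
  The set \<open>S\<close> is always an open set or a linear subspace. On a proper subspace the derivative
  within \<open>S\<close> is determined only on directions in \<open>S\<close>; the definitions then
  ask for some choice of derivative which is continuous (respectively of class $C^1$), which is the
  same as \<open>f\<close> being of class $C^1$ (respectively $C^2$) on the vector space \<open>S\<close>.
\<close>

definition C1_on :: "'m::real_normed_vector set \<Rightarrow> ('m \<Rightarrow> 'b::real_normed_vector) \<Rightarrow> bool" where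
  "C1_on S f \<longleftrightarrow> (\<exists>D :: 'm \<Rightarrow> 'm \<Rightarrow>\<^sub>L 'b.
     (\<forall>x\<in>S. (f has_derivative blinfun_apply (D x)) (at x within S)) \<and> continuous_on S D)"

definition C2_on :: "'m::real_normed_vector set \<Rightarrow> ('m \<Rightarrow> 'b::real_normed_vector) \<Rightarrow> bool" where
  "C2_on S f \<longleftrightarrow> (\<exists>D :: 'm \<Rightarrow> 'm \<Rightarrow>\<^sub>L 'b.
     (\<forall>x\<in>S. (f has_derivative blinfun_apply (D x)) (at x within S)) \<and> C1_on S D)"

text \<open>
  A function on the unit sphere, a closed submanifold of \<open>'a\<close>, is of class $C^1$ iff it
  is the restriction of a $C^1$ function on an open neighbourhood of the sphere. Values of
  \<open>H\<close> off the sphere are irrelevant.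
\<close>

definition C1_sphere :: "('a::euclidean_space \<Rightarrow> real) \<Rightarrow> bool" where
  "C1_sphere H \<longleftrightarrow>
     (\<exists>U F. open U \<and> sphere 0 1 \<subseteq> U \<and> C1_on U F \<and> (\<forall>x\<in>sphere 0 1. F x = H x))"

section \<open>Oriented hypersurfaces and their mean curvature\<close>

text \<open>
  The ambient space is \<open>'a\<close>, with \<open>DIM('a) = n + 1\<close>. A hypersurface is given by an immersion
  \<open>\<psi>\<close> of an \<open>n\<close>-dimensional linear space \<open>W\<close>, together with
  its Gauss map \<open>\<eta>\<close>. One global chart suffices for the hypersurfaces considered here.
  Using a subspace \<open>W\<close> of \<open>'m\<close>, rather than a type of dimension \<open>n\<close>, allows
  \<open>W = \<real> \<times> P\<^sup>\<bottom>\<close>, also when \<open>P\<^sup>\<bottom>\<close> is trivial.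
\<close>

definition tangent_space ::
    "'m::euclidean_space set \<Rightarrow> ('m \<Rightarrow> 'a::euclidean_space) \<Rightarrow> 'm \<Rightarrow> 'a set" where
  "tangent_space W \<psi> x = frechet_derivative \<psi> (at x within W) ` W"

definition immersed_oriented_hypersurface ::
    "'m::euclidean_space set \<Rightarrow> ('m \<Rightarrow> 'a::euclidean_space) \<Rightarrow> ('m \<Rightarrow> 'a) \<Rightarrow> bool" where
  "immersed_oriented_hypersurface W \<psi> \<eta> \<longleftrightarrow>
     subspace W \<and> dim W + 1 = DIM('a) \<and>
     C2_on W \<psi> \<and> (\<forall>x\<in>W. inj_on (frechet_derivative \<psi> (at x within W)) W) \<and>
     C1_on W \<eta> \<and>
     (\<forall>x\<in>W. norm (\<eta> x) = 1 \<and> (\<forall>u\<in>tangent_space W \<psi> x. orthogonal (\<eta> x) u))"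

text \<open>
  The shape operator is \<open>- d\<eta>\<close>, transported to the tangent hyperplane by
  \<open>d\<psi>\<close>. It is extended by zero to the normal line, so that its trace can be
  computed in the ambient space. With the sign chosen here, the unit sphere with its inner normal
  \<open>\<eta> = - \<psi>\<close> has the identity as its shape operator and has mean curvature 1.
\<close>

definition shape_operator ::
    "'m::euclidean_space set \<Rightarrow> ('m \<Rightarrow> 'a::euclidean_space) \<Rightarrow> ('m \<Rightarrow> 'a) \<Rightarrow> 'm \<Rightarrow> 'a \<Rightarrow> 'a" where
  "shape_operator W \<psi> \<eta> x = (THE A. linear A \<and> A (\<eta> x) = 0 \<and>
     (\<forall>w\<in>W. A (frechet_derivative \<psi> (at x within W) w)
              = - frechet_derivative \<eta> (at x within W) w))"

definition mean_curvature ::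
    "'m::euclidean_space set \<Rightarrow> ('m \<Rightarrow> 'a::euclidean_space) \<Rightarrow> ('m \<Rightarrow> 'a) \<Rightarrow> 'm \<Rightarrow> real" where
  "mean_curvature W \<psi> \<eta> x =
     (\<Sum>b\<in>Basis. inner (shape_operator W \<psi> \<eta> x b) b) / real (dim W)"

definition H_hypersurface ::
    "('a::euclidean_space \<Rightarrow> real) \<Rightarrow> 'm::euclidean_space set \<Rightarrow> ('m \<Rightarrow> 'a) \<Rightarrow> ('m \<Rightarrow> 'a) \<Rightarrow> bool" where
  "H_hypersurface H W \<psi> \<eta> \<longleftrightarrow>
     immersed_oriented_hypersurface W \<psi> \<eta> \<and>
     (\<forall>x\<in>W. mean_curvature W \<psi> \<eta> x = H (\<eta> x))"

section \<open>Complete regular curves and the cylinders over them\<close>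

definition arc_distance :: "(real \<Rightarrow> 'a::euclidean_space) \<Rightarrow> real \<Rightarrow> real \<Rightarrow> real" where
  "arc_distance \<alpha> s t = integral {min s t..max s t} (\<lambda>u. norm (vector_derivative \<alpha> (at u)))"

text \<open>
  Curves are parametrized by the real line, closed ones by periodic maps. Completeness is that of
  the metric induced on the parameter line.
\<close>

definition complete_regular_curve :: "(real \<Rightarrow> 'a::euclidean_space) \<Rightarrow> bool" where
  "complete_regular_curve \<alpha> \<longleftrightarrow>
     C2_on UNIV \<alpha> \<and> (\<forall>s. vector_derivative \<alpha> (at s) \<noteq> 0) \<and>
     Metric_space.mcomplete UNIV (arc_distance \<alpha>)"

definition cylinder_domain :: "'a::euclidean_space set \<Rightarrow> (real \<times> 'a) set" where
  "cylinder_domain P = UNIV \<times> orthogonal_comp P"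

definition cylinder :: "(real \<Rightarrow> 'a::euclidean_space) \<Rightarrow> real \<times> 'a \<Rightarrow> 'a" where
  "cylinder \<alpha> = (\<lambda>(s, p). \<alpha> s + p)"

definition complete_flat_H_hypersurface ::
    "('a::euclidean_space \<Rightarrow> real) \<Rightarrow> 'a set \<Rightarrow> (real \<Rightarrow> 'a) \<Rightarrow> (real \<times> 'a \<Rightarrow> 'a) \<Rightarrow> bool" where
  "complete_flat_H_hypersurface H P \<alpha> \<eta> \<longleftrightarrow>
     subspace P \<and> dim P = 2 \<and> complete_regular_curve \<alpha> \<and> range \<alpha> \<subseteq> P \<and>
     H_hypersurface H (cylinder_domain P) (cylinder \<alpha>) \<eta>"

text \<open>
  The identification of the plane \<open>P\<close> with $\mathbb{R}^2$ orients \<open>P\<close>;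
  \<open>J\<close> is the corresponding rotation by a quarter turn. Its values off \<open>P\<close>
  are irrelevant.
\<close>

definition quarter_turn :: "'a::euclidean_space set \<Rightarrow> ('a \<Rightarrow> 'a) \<Rightarrow> bool" where
  "quarter_turn P J \<longleftrightarrow>
     linear J \<and> (\<forall>x\<in>P. J x \<in> P \<and> norm (J x) = norm x \<and> orthogonal (J x) x)"

text \<open>
  Tangency is understood in the oriented sense: \<open>v\<close> is tangent to the hypersurface at a
  point where \<open>v\<close>, \<open>\<eta>\<close> is a positively oriented frame of \<open>P\<close>;
  equivalently, once the curve is traversed so that \<open>\<eta>\<close> is its left normal,
  \<open>v\<close> is its unit tangent at that point. Without the
  orientation the curve is not unique: if \<open>H (J v) = 0\<close> but
  \<open>H (- J v) \<noteq> 0\<close>, then \<open>v\<close> is tangent both to the hyperplane with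
  normal \<open>J v\<close> and to a curved flat hypersurface with normal
  \<open>- J v\<close> at the point of tangency.
\<close>

definition tangent_flat_H_hypersurface ::
    "('a::euclidean_space \<Rightarrow> real) \<Rightarrow> 'a set \<Rightarrow> ('a \<Rightarrow> 'a) \<Rightarrow> 'a \<Rightarrow>
      (real \<Rightarrow> 'a) \<Rightarrow> (real \<times> 'a \<Rightarrow> 'a) \<Rightarrow> bool" where
  "tangent_flat_H_hypersurface H P J v \<alpha> \<eta> \<longleftrightarrow>
     complete_flat_H_hypersurface H P \<alpha> \<eta> \<and>
     (\<exists>x\<in>cylinder_domain P. v \<in> tangent_space (cylinder_domain P) (cylinder \<alpha>) x \<and> \<eta> x = J v)"

text \<open>
  Equality up to translation, as oriented hypersurfaces. Curves are taken up to regular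
  reparametrization, which may reverse the direction; the Gauss maps have to correspond.
\<close>

definition equal_up_to_translation ::
    "'a::euclidean_space set \<Rightarrow> (real \<Rightarrow> 'a) \<Rightarrow> (real \<times> 'a \<Rightarrow> 'a) \<Rightarrow>
      (real \<Rightarrow> 'a) \<Rightarrow> (real \<times> 'a \<Rightarrow> 'a) \<Rightarrow> bool" where
  "equal_up_to_translation P \<alpha> \<eta> \<beta> \<zeta> \<longleftrightarrow>
     (\<exists>\<phi> :: real \<Rightarrow> real. \<exists>c.
        bij \<phi> \<and> C2_on UNIV \<phi> \<and> (\<forall>s. vector_derivative \<phi> (at s) \<noteq> 0) \<and>
        (\<forall>s. \<beta> s = \<alpha> (\<phi> s) + c) \<and> (\<forall>s. \<forall>p\<in>orthogonal_comp P. \<zeta> (s, p) = \<eta> (\<phi> s, p)))"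

end

theory Submission
  imports Defs
begin

text \<open>
  Everything happens in the plane \<open>P\<close>. Let \<open>n + 1\<close> be the dimension of the ambient space. The
  Gauss map of a cylinder over a curve in \<open>P\<close> takes values in \<open>P\<close> and is constant along the
  rulings, so it has the form \<open>J \<tau>\<close> for a unit field \<open>\<tau>\<close> along the curve that is tangent to it.
  The only principal curvature that can be nonzero is the curvature of the curve, whence the mean
  curvature is that curvature divided by \<open>n\<close>. If \<open>\<rho>\<close> is the signed speed, that is
  \<open>\<alpha>' = \<rho> \<tau>\<close>, then the cylinder is an \<open>H\<close>-hypersurface exactly when
  \<open>\<tau>' = \<rho> n H(J \<tau>) J \<tau>\<close>. The predicate \<open>H_frame\<close> records this system, and
  \<open>H_frame_imp_H_hypersurface\<close> and \<open>complete_flat_H_hypersurface_imp_H_frame\<close> are the two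
  directions of the equivalence.

  For \<open>\<rho> = 1\<close> the equation for \<open>\<tau>\<close> is an autonomous differential equation on the unit circle of
  \<open>P\<close>. Its right-hand side is Lipschitz because \<open>H\<close> is of class $C^1$. In terms of the angle of
  \<open>\<tau>\<close> against \<open>v\<close> it is a scalar equation with a globally Lipschitz right-hand side, so there is
  a solution on the whole line with \<open>\<tau> = v\<close> at time 0, and integrating \<open>\<tau>\<close> gives the curve
  (\<open>H_frame_exists\<close>).

  Conversely, let any complete example be given. The integral of its signed speed \<open>\<rho>\<close> is a
  diffeomorphism \<open>\<phi>\<close> of the line, onto by completeness (\<open>arc_length_bij\<close>). Its frame
  \<open>\<tau>\<close> and the frame of the unit speed solution composed with \<open>\<phi>\<close> solve the same equation, so
  they agree if they agree at one parameter, by a Gronwall argument; then the two curves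
  differ by a translation (\<open>H_frames_equal_up_to_translation\<close>). An example
  that is tangent to \<open>v\<close> with normal \<open>J v\<close> has \<open>\<tau> = v\<close> at the point of tangency. An arbitrary
  example is compared with the solution that starts at the value of its own \<open>\<tau>\<close> at parameter 0.
\<close>

section \<open>Derivatives within a subspace and maps of class C1\<close>

text \<open>
  Derivatives within a proper subspace are not unique as linear maps, but restricting \<open>f\<close> to the
  line through \<open>x\<close> in a direction of the subspace yields an honest one-variable derivative.
\<close>
lemma has_derivative_within_subspace_unique:
  assumes f1: "(f has_derivative f1) (at x within W)" and f2: "(f has_derivative f2) (at x within W)"
    and W: "subspace W" "x \<in> W" "w \<in> W"
  shows "f1 w = f2 w"
proof -
  have line: "((\<lambda>t. f (x + t *\<^sub>R w)) has_vector_derivative g w) (at 0)"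
    if g: "(f has_derivative g) (at x within W)" for g
  proof -
    have "((\<lambda>t::real. x + t *\<^sub>R w) has_derivative (\<lambda>t. t *\<^sub>R w)) (at 0)"
      by (auto intro!: derivative_eq_intros)
    moreover have "(\<lambda>t. x + t *\<^sub>R w) ` UNIV \<subseteq> W"
      using W by (auto intro!: subspace_add subspace_scale)
    ultimately have "((\<lambda>t. f (x + t *\<^sub>R w)) has_derivative (\<lambda>t. g (t *\<^sub>R w))) (at 0)"
      using has_derivative_in_compose[of "\<lambda>t. x + t *\<^sub>R w" "\<lambda>t. t *\<^sub>R w" 0 UNIV f g]
        has_derivative_subset[OF g] by simp
    then show ?thesis
      by (simp add: has_vector_derivative_def linear_scale[OF has_derivative_linear[OF g]])
  qed
  show ?thesis
    using vector_derivative_unique_at[OF line[OF f1] line[OF f2]] .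
qed

text \<open>
  The arbitrary choice hidden in \<open>frechet_derivative\<close> is thus harmless on the subspace itself.
\<close>
lemma frechet_derivative_within_subspace:
  assumes "(f has_derivative f') (at x within W)" "subspace W" "x \<in> W" "w \<in> W"
  shows "frechet_derivative f (at x within W) w = f' w"
proof -
  have "f differentiable (at x within W)"
    using assms(1) by (auto simp: differentiable_def)
  then have "(f has_derivative frechet_derivative f (at x within W)) (at x within W)"
    by (simp add: frechet_derivative_works)
  then show ?thesis
    using has_derivative_within_subspace_unique assms by blast
qed

lemma C1_on_imp_continuous_on:
  assumes "C1_on S f"
  shows "continuous_on S f"
proof -
  obtain D where "\<And>x. x \<in> S \<Longrightarrow> (f has_derivative blinfun_apply (D x)) (at x within S)"
    using assms unfolding C1_on_def by blast
  then show ?thesis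
    by (rule has_derivative_continuous_on)
qed

lemma C1_on_compose:
  assumes g: "C1_on T g" and f: "C1_on S f" and "f ` S \<subseteq> T"
  shows "C1_on S (\<lambda>x. g (f x))"
proof -
  obtain Dg where Dg: "\<And>y. y \<in> T \<Longrightarrow> (g has_derivative blinfun_apply (Dg y)) (at y within T)"
      "continuous_on T Dg"
    using g by (auto simp: C1_on_def)
  obtain Df where Df: "\<And>x. x \<in> S \<Longrightarrow> (f has_derivative blinfun_apply (Df x)) (at x within S)"
      "continuous_on S Df"
    using f by (auto simp: C1_on_def)
  have contf: "continuous_on S f"
    by (rule has_derivative_continuous_on[OF Df(1)])
  show ?thesis
    unfolding C1_on_def
  proof (intro exI[of _ "\<lambda>x. Dg (f x) o\<^sub>L Df x"] conjI ballI)
    fix x assume x: "x \<in> S"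
    have "((\<lambda>x. g (f x)) has_derivative (\<lambda>h. Dg (f x) (Df x h))) (at x within S)"
      by (rule has_derivative_in_compose[OF Df(1)[OF x] has_derivative_subset[OF Dg(1) assms(3)]])
        (use assms(3) x in auto)
    then show "((\<lambda>x. g (f x)) has_derivative blinfun_apply (Dg (f x) o\<^sub>L Df x)) (at x within S)"
      by (simp add: blinfun_compose.rep_eq o_def)
  next
    show "continuous_on S (\<lambda>x. Dg (f x) o\<^sub>L Df x)"
      by (rule bounded_bilinear.continuous_on[OF bounded_bilinear_blinfun_compose
            continuous_on_compose2[OF Dg(2) contf assms(3)] Df(2)])
  qed
qed

lemma C1_on_bounded_linear:
  assumes "bounded_linear L"
  shows "C1_on S L"
  unfolding C1_on_def
  using bounded_linear_imp_has_derivative[OF assms]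
  by (intro exI[of _ "\<lambda>_. Blinfun L"]) (auto simp: bounded_linear_Blinfun_apply[OF assms])

lemma C1_on_add_const:
  assumes "C1_on S f"
  shows "C1_on S (\<lambda>x. f x + c)"
  using assms unfolding C1_on_def by (auto intro!: derivative_eq_intros)

lemma has_derivative_imp_has_vector_derivative_1:
  assumes "(f has_derivative f') (at (s::real))"
  shows "(f has_vector_derivative f' 1) (at s)"
proof -
  have "f' h = h *\<^sub>R f' 1" for h
    using linear_scale[OF has_derivative_linear[OF assms], of h 1] by simp
  then have "f' = (\<lambda>h. h *\<^sub>R f' 1)"
    by blast
  with assms show ?thesis
    by (simp add: has_vector_derivative_def)
qed

text \<open>
  For curves, operator-valued derivatives can be traded for derivative vectors, since evaluation at
  1 and \<open>blinfun_scaleR_left\<close> are bounded linear and inverse to each other. The same argument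
  applies to $C^2$ curves.
\<close>
lemma C1_on_curve_iff:
  "C1_on UNIV g \<longleftrightarrow>
     (\<exists>g'. (\<forall>s::real. (g has_vector_derivative g' s) (at s)) \<and> continuous_on UNIV g')"
proof
  assume "C1_on UNIV g"
  then obtain D where D: "\<And>s. (g has_derivative blinfun_apply (D s)) (at s)" "continuous_on UNIV D"
    by (auto simp: C1_on_def)
  have "(g has_vector_derivative D s 1) (at s)" for s
    using D(1)[of s] by (rule has_derivative_imp_has_vector_derivative_1)
  moreover have "continuous_on UNIV (\<lambda>s. D s 1)"
    using D(2) by (intro continuous_intros)
  ultimately show "\<exists>g'. (\<forall>s. (g has_vector_derivative g' s) (at s)) \<and> continuous_on UNIV g'"
    by (intro exI[of _ "\<lambda>s. D s 1"]) simp
next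
  assume "\<exists>g'. (\<forall>s. (g has_vector_derivative g' s) (at s)) \<and> continuous_on UNIV g'"
  then obtain g' where g': "\<And>s. (g has_vector_derivative g' s) (at s)" "continuous_on UNIV g'"
    by auto
  show "C1_on UNIV g"
    unfolding C1_on_def
    using g' by (intro exI[of _ "\<lambda>s. blinfun_scaleR_left (g' s)"])
      (auto simp: has_vector_derivative_def intro!: continuous_intros)
qed

lemma C2_on_curve_iff:
  "C2_on UNIV g \<longleftrightarrow>
     (\<exists>g'. (\<forall>s::real. (g has_vector_derivative g' s) (at s)) \<and> C1_on UNIV g')"
proof
  assume "C2_on UNIV g"
  then obtain D where D: "\<And>s. (g has_derivative blinfun_apply (D s)) (at s)" "C1_on UNIV D"
    by (auto simp: C2_on_def)
  have "(g has_vector_derivative D s 1) (at s)" for s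
    using D(1)[of s] by (rule has_derivative_imp_has_vector_derivative_1)
  moreover have "C1_on UNIV (\<lambda>s. D s 1)"
    by (rule C1_on_compose[OF C1_on_bounded_linear D(2)])
      (auto intro: blinfun.bounded_linear_left)
  ultimately show "\<exists>g'. (\<forall>s. (g has_vector_derivative g' s) (at s)) \<and> C1_on UNIV g'"
    by (intro exI[of _ "\<lambda>s. D s 1"]) simp
next
  assume "\<exists>g'. (\<forall>s. (g has_vector_derivative g' s) (at s)) \<and> C1_on UNIV g'"
  then obtain g' where g': "\<And>s. (g has_vector_derivative g' s) (at s)" "C1_on UNIV g'"
    by auto
  have "C1_on UNIV (\<lambda>s. blinfun_scaleR_left (g' s))"
    by (rule C1_on_compose[OF C1_on_bounded_linear g'(2)])
      (auto intro: bounded_linear_blinfun_scaleR_left)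
  then show "C2_on UNIV g"
    unfolding C2_on_def
    using g'(1) by (intro exI[of _ "\<lambda>s. blinfun_scaleR_left (g' s)"])
      (auto simp: has_vector_derivative_def)
qed

lemma has_vector_derivative_inner:
  assumes "(f has_vector_derivative f') (at s)" "(g has_vector_derivative g') (at s)"
  shows "((\<lambda>s. f s \<bullet> g s) has_vector_derivative f s \<bullet> g' + f' \<bullet> g s) (at s)"
  using has_derivative_inner[OF assms[unfolded has_vector_derivative_def]]
  by (simp add: has_vector_derivative_def algebra_simps)

lemma C1_on_curve_inner:
  assumes "C1_on UNIV f" "C1_on UNIV g"
  shows "C1_on UNIV (\<lambda>s::real. f s \<bullet> g s)"
proof -
  obtain f' where f': "\<And>s. (f has_vector_derivative f' s) (at s)" "continuous_on UNIV f'"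
    using assms(1) by (auto simp: C1_on_curve_iff)
  obtain g' where g': "\<And>s. (g has_vector_derivative g' s) (at s)" "continuous_on UNIV g'"
    using assms(2) by (auto simp: C1_on_curve_iff)
  have "continuous_on UNIV f" "continuous_on UNIV g"
    using f'(1) g'(1) by (auto intro!: continuous_at_imp_continuous_on has_vector_derivative_continuous)
  then have "continuous_on UNIV (\<lambda>s. f s \<bullet> g' s + f' s \<bullet> g s)"
    using f'(2) g'(2) by (intro continuous_intros)
  then show ?thesis
    unfolding C1_on_curve_iff using has_vector_derivative_inner[OF f'(1) g'(1)]
    by (intro exI[of _ "\<lambda>s. f s \<bullet> g' s + f' s \<bullet> g s"]) simp
qed

lemma C1_on_curve_scaleR:
  assumes "C1_on UNIV f" "C1_on UNIV g"
  shows "C1_on UNIV (\<lambda>s::real. f s *\<^sub>R g s)"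
proof -
  obtain f' where f': "\<And>s. (f has_vector_derivative f' s) (at s)" "continuous_on UNIV f'"
    using assms(1) by (auto simp: C1_on_curve_iff)
  obtain g' where g': "\<And>s. (g has_vector_derivative g' s) (at s)" "continuous_on UNIV g'"
    using assms(2) by (auto simp: C1_on_curve_iff)
  have "continuous_on UNIV f" "continuous_on UNIV g"
    using f'(1) g'(1) by (auto intro!: continuous_at_imp_continuous_on has_vector_derivative_continuous)
  then have "continuous_on UNIV (\<lambda>s. f s *\<^sub>R g' s + f' s *\<^sub>R g s)"
    using f'(2) g'(2) by (intro continuous_intros)
  then show ?thesis
    unfolding C1_on_curve_iff
    using has_vector_derivative_scaleR[OF f'(1)[folded has_real_derivative_iff_has_vector_derivative] g'(1)]
    by (intro exI[of _ "\<lambda>s. f s *\<^sub>R g' s + f' s *\<^sub>R g s"]) simp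
qed

section \<open>Global solutions of Lipschitz differential equations\<close>

lemma antiderivative_exists:
  fixes g :: "real \<Rightarrow> 'a::euclidean_space"
  assumes "continuous_on UNIV g"
  obtains G where "\<And>s. (G has_vector_derivative g s) (at s)" "G a = 0"
proof -
  have "isCont g x" for x
    using assms continuous_on_eq_continuous_at by blast
  then obtain F where F: "\<And>x. (F has_vector_derivative g x) (at x)"
    using einterval_antiderivative[of "-\<infinity>" "\<infinity>" g] by auto
  then have "((\<lambda>s. F s - F a) has_vector_derivative g s) (at s)" for s
    by (auto intro!: derivative_eq_intros)
  then show ?thesis
    using that[of "\<lambda>s. F s - F a"] by simp
qed

lemma curves_differ_by_constant:
  assumes "\<And>s::real. (f has_vector_derivative h s) (at s)"
    and "\<And>s. (g has_vector_derivative h s) (at s)"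
  obtains c where "\<And>s. f s = g s + c"
proof -
  have "((\<lambda>s. f s - g s) has_vector_derivative 0) (at s)" for s
    using has_vector_derivative_diff[OF assms] by simp
  then obtain c where "\<And>s. f s - g s = c"
    using has_vector_derivative_zero_constant[of UNIV "\<lambda>s. f s - g s"] by auto
  then show ?thesis
    using that by (metis add.commute diff_add_cancel)
qed

text \<open>
  This is the estimate behind the weighted norm in the existence proof: integrating from 0 an
  integrand of growth \<open>exp (K * \<bar>t\<bar>)\<close> reproduces that growth and gains a factor \<open>1 / K\<close>. Negative
  times are reduced to positive ones by reflection.
\<close>
lemma norm_curve_le_exp:
  fixes D :: "real \<Rightarrow> 'a::real_normed_vector"
  assumes D: "\<And>t. (D has_vector_derivative D' t) (at t)" and "D 0 = 0"
    and bound: "\<And>t. norm (D' t) \<le> M * exp (K * \<bar>t\<bar>)" and "K > 0"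
  shows "norm (D s) \<le> M / K * exp (K * \<bar>s\<bar>)"
proof -
  have M: "M \<ge> 0"
    using order_trans[OF norm_ge_zero bound[of 0]] by simp
  have right: "norm (E s) \<le> M / K * exp (K * \<bar>s\<bar>)"
    if E: "\<And>t. (E has_vector_derivative E' t) (at t)" "E 0 = 0"
      "\<And>t. norm (E' t) \<le> M * exp (K * \<bar>t\<bar>)" and "s > 0" for E :: "real \<Rightarrow> 'a" and E' s
  proof -
    have "norm (E s - E 0) \<le> M / K * exp (K * s) - M / K * exp (K * 0)"
    proof (rule differentiable_bound_general[OF \<open>s > 0\<close>])
      show "continuous_on {0..s} E"
        using E(1) by (blast intro: continuous_at_imp_continuous_on has_vector_derivative_continuous)
      show "continuous_on {0..s} (\<lambda>t. M / K * exp (K * t))"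
        by (intro continuous_intros)
      show "((\<lambda>t. M / K * exp (K * t)) has_vector_derivative M * exp (K * t)) (at t)" for t
        unfolding has_real_derivative_iff_has_vector_derivative[symmetric]
        using \<open>K > 0\<close> by (auto intro!: derivative_eq_intros)
      show "norm (E' t) \<le> M * exp (K * t)" if "0 < t" for t
        using E(3)[of t] that by simp
    qed (rule E(1))
    also have "\<dots> \<le> M / K * exp (K * \<bar>s\<bar>)"
      using M \<open>K > 0\<close> \<open>s > 0\<close> by simp
    finally show ?thesis
      using E(2) by simp
  qed
  consider "s > 0" | "s = 0" | "s < 0"
    by linarith
  then show ?thesis
  proof cases
    case 1
    then show ?thesis
      using right[OF D \<open>D 0 = 0\<close> bound] by blast
  next
    case 2
    then show ?thesis
      using M \<open>K > 0\<close> \<open>D 0 = 0\<close> by simp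
  next
    case 3
    have "((\<lambda>t. D (- t)) has_vector_derivative - D' (- t)) (at t)" for t
    proof -
      have "((\<lambda>t::real. - t) has_vector_derivative - 1) (at t)"
        by (auto intro!: derivative_eq_intros)
      from vector_diff_chain_at[OF this D] show ?thesis
        by (simp add: o_def)
    qed
    from right[OF this, of "- s"] show ?thesis
      using 3 bound \<open>D 0 = 0\<close> by (simp) (metis abs_minus_cancel)
  qed
qed

text \<open>
  Picard iteration converges on the whole line at once if functions are measured with the weight
  \<open>exp (- K * \<bar>t\<bar>)\<close> for a large \<open>K\<close>, so that no continuation of local solutions is required.
  In the proof, \<open>u\<close> ranges over bounded continuous functions, \<open>X u\<close> is the candidate solution
  \<open>x0 + exp (K * \<bar>t\<bar>) * u\<close>, and \<open>Psi u\<close> is the rescaled integral of \<open>f (X u)\<close>.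
\<close>
theorem global_autonomous_ode_solution:
  fixes f :: "'a::euclidean_space \<Rightarrow> 'a"
  assumes f: "L-lipschitz_on UNIV f"
  obtains x where "\<And>t. (x has_vector_derivative f (x t)) (at t)" "x 0 = x0"
proof -
  \<comment> \<open>Any \<open>K \<ge> 2 * L\<close> gives contraction factor 1/2; adding 1 keeps \<open>K\<close> positive when \<open>L = 0\<close>.\<close>
  define K where "K = 2 * (L + 1)"
  have L: "L \<ge> 0"
    using f lipschitz_on_nonneg by blast
  then have K: "K > 0"
    by (simp add: K_def)
  have contf: "continuous_on UNIV f"
    by (rule lipschitz_on_continuous_on[OF f])
  have lip: "norm (f x - f y) \<le> L * norm (x - y)" for x y
    using lipschitz_on_normD[OF f] by blast
  define X :: "(real \<Rightarrow>\<^sub>C 'a) \<Rightarrow> real \<Rightarrow> 'a" where "X u t = x0 + exp (K * \<bar>t\<bar>) *\<^sub>R u t" for u t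
  have "\<exists>G. (\<forall>t. (G has_vector_derivative f (X u t)) (at t)) \<and> G 0 = 0" for u
  proof -
    have "continuous_on UNIV (\<lambda>t. f (X u t))"
      unfolding X_def by (rule continuous_on_compose2[OF contf]) (auto intro!: continuous_intros)
    then show ?thesis
      by (rule antiderivative_exists[where a = 0]) blast
  qed
  then have "\<exists>G. \<forall>u. (\<forall>t. (G u has_vector_derivative f (X u t)) (at t)) \<and> G u 0 = 0"
    by (intro choice) simp
  then obtain G where G: "\<And>u t. (G u has_vector_derivative f (X u t)) (at t)" "\<And>u. G u 0 = 0"
    by blast
  have G_bound: "norm (G u t) \<le> (norm (f x0) + L * norm u) / K * exp (K * \<bar>t\<bar>)" for u t
  proof (rule norm_curve_le_exp[where D' = "\<lambda>t. f (X u t)", OF G _ K])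
    fix t
    have "norm (X u t - x0) \<le> exp (K * \<bar>t\<bar>) * norm u"
      by (simp add: X_def norm_bounded)
    note growth = mult_left_mono[OF this L]
    have "norm (f (X u t)) \<le> norm (f x0) + norm (f (X u t) - f x0)"
      using norm_triangle_ineq[of "f x0" "f (X u t) - f x0"] by simp
    also have "\<dots> \<le> norm (f x0) + L * (exp (K * \<bar>t\<bar>) * norm u)"
      using lip[of "X u t" x0] growth by linarith
    also have "\<dots> \<le> norm (f x0) * exp (K * \<bar>t\<bar>) + L * (exp (K * \<bar>t\<bar>) * norm u)"
      using mult_left_mono[of 1 "exp (K * \<bar>t\<bar>)" "norm (f x0)"] K by simp
    finally show "norm (f (X u t)) \<le> (norm (f x0) + L * norm u) * exp (K * \<bar>t\<bar>)"
      by (simp add: algebra_simps)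
  qed
  have cancel: "exp (- K * \<bar>t\<bar>) * (c * exp (K * \<bar>t\<bar>)) = c" for c t
    by (simp add: exp_minus)
  have contG: "continuous_on UNIV (G u)" for u
    using G(1) by (blast intro: continuous_at_imp_continuous_on has_vector_derivative_continuous)
  define Psi where "Psi u = Bcontfun (\<lambda>t. exp (- K * \<bar>t\<bar>) *\<^sub>R G u t)" for u
  have "(\<lambda>t. exp (- K * \<bar>t\<bar>) *\<^sub>R G u t) \<in> bcontfun" for u
  proof (rule bcontfun_normI)
    show "continuous_on UNIV (\<lambda>t. exp (- K * \<bar>t\<bar>) *\<^sub>R G u t)"
      by (intro continuous_intros contG)
    show "norm (exp (- K * \<bar>t\<bar>) *\<^sub>R G u t) \<le> (norm (f x0) + L * norm u) / K" for t
      using mult_left_mono[OF G_bound[of u t], of "exp (- K * \<bar>t\<bar>)"]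
      by (simp only: cancel exp_ge_zero simp_thms norm_scaleR abs_exp_cancel)
  qed
  then have Psi: "apply_bcontfun (Psi u) = (\<lambda>t. exp (- K * \<bar>t\<bar>) *\<^sub>R G u t)" for u
    unfolding Psi_def by (rule Bcontfun_inverse)
  have contraction: "dist (Psi u) (Psi w) \<le> (1/2) * dist u w" for u w
  proof (rule dist_bound)
    fix t
    have "norm (G u t - G w t) \<le> L * dist u w / K * exp (K * \<bar>t\<bar>)"
    proof (rule norm_curve_le_exp[OF has_vector_derivative_diff[OF G(1) G(1)] _ _ K])
      fix t
      have "norm (f (X u t) - f (X w t)) \<le> L * norm (exp (K * \<bar>t\<bar>) *\<^sub>R (u t - w t))"
      proof -
        have "X u t - X w t = exp (K * \<bar>t\<bar>) *\<^sub>R (u t - w t)"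
          by (simp add: X_def scaleR_diff_right)
        then show ?thesis
          using lip[of "X u t" "X w t"] by simp
      qed
      also have "\<dots> = L * exp (K * \<bar>t\<bar>) * dist (u t) (w t)"
        by (simp add: dist_norm)
      also have "\<dots> \<le> L * exp (K * \<bar>t\<bar>) * dist u w"
        using L by (intro mult_left_mono dist_bounded) auto
      finally show "norm (f (X u t) - f (X w t)) \<le> L * dist u w * exp (K * \<bar>t\<bar>)"
        by (simp add: mult_ac)
    qed (simp add: G(2))
    from mult_left_mono[OF this, of "exp (- K * \<bar>t\<bar>)"]
    have "exp (- K * \<bar>t\<bar>) * norm (G u t - G w t) \<le> L * dist u w / K"
      by (simp only: cancel exp_ge_zero simp_thms)
    moreover have "dist (Psi u t) (Psi w t) = exp (- K * \<bar>t\<bar>) * norm (G u t - G w t)"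
      unfolding Psi dist_norm scaleR_diff_right[symmetric] norm_scaleR by simp
    ultimately have "dist (Psi u t) (Psi w t) \<le> (L / K) * dist u w"
      by simp
    also have "\<dots> \<le> (1/2) * dist u w"
    proof (rule mult_right_mono)
      show "L / K \<le> 1 / 2"
        unfolding pos_divide_le_eq[OF K] using L by (simp add: K_def)
    qed simp
    finally show "dist (Psi u t) (Psi w t) \<le> (1/2) * dist u w" .
  qed
  obtain u where u: "Psi u = u"
  proof -
    have "\<exists>!u. Psi u = u"
      by (rule banach_fix_type[of "1/2"]) (use contraction in simp_all)
    then show ?thesis
      using that by blast
  qed
  have "G u t = exp (K * \<bar>t\<bar>) *\<^sub>R u t" for t
  proof -
    have "u t = exp (- K * \<bar>t\<bar>) *\<^sub>R G u t"
      using Psi[of u] u by simp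
    then show ?thesis
      by (simp add: exp_minus)
  qed
  then have X: "X u t = x0 + G u t" for t
    by (simp add: X_def)
  show ?thesis
  proof
    have "((\<lambda>t. x0 + G u t) has_vector_derivative f (X u t)) (at t)" for t
      using G(1)[of u t] by (auto intro!: derivative_eq_intros)
    then show "(X u has_vector_derivative f (X u t)) (at t)" for t
      by (simp add: X[symmetric])
    show "X u 0 = x0"
      by (simp add: X G(2))
  qed
qed

text \<open>
  Gronwall: \<open>(norm (D t))\<^sup>2 * exp (- 2 * K t)\<close> is nonincreasing and \<open>(norm (D t))\<^sup>2 * exp (2 * K t)\<close> is
  nondecreasing, so a zero of \<open>D\<close> spreads both to the right and to the left. Taking the bound as the
  derivative \<open>k\<close> of a given \<open>K\<close> allows a time-dependent rate.
\<close>
lemma linearly_bounded_derivative_imp_zero: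
  fixes D :: "real \<Rightarrow> 'a::real_inner"
  assumes D: "\<And>t. (D has_vector_derivative D' t) (at t)"
    and K: "\<And>t. (K has_real_derivative k t) (at t)"
    and bound: "\<And>t. norm (D' t) \<le> k t * norm (D t)" and "D a = 0"
  shows "D s = 0"
proof -
  define g where "g t = (norm (D t))\<^sup>2" for t
  define g' where "g' t = 2 * (D t \<bullet> D' t)" for t
  have g: "(g has_real_derivative g' t) (at t)" for t
  proof -
    have "g = (\<lambda>t. D t \<bullet> D t)"
      by (simp add: g_def fun_eq_iff dot_square_norm)
    moreover have "g' t = D t \<bullet> D' t + D' t \<bullet> D t"
      by (simp add: g'_def inner_commute)
    ultimately show ?thesis
      using has_vector_derivative_inner[OF D D, of t]
      by (simp only: has_real_derivative_iff_has_vector_derivative)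
  qed
  have g': "\<bar>g' t\<bar> \<le> 2 * k t * g t" for t
  proof -
    have "\<bar>D t \<bullet> D' t\<bar> \<le> norm (D t) * (k t * norm (D t))"
      using Cauchy_Schwarz_ineq2[of "D t" "D' t"] mult_left_mono[OF bound[of t] norm_ge_zero[of "D t"]]
      by linarith
    then show ?thesis
      by (simp add: g_def g'_def power2_eq_square mult_ac)
  qed
  have "g s \<le> 0"
  proof (cases "a \<le> s")
    case True
    have "g s * exp (- 2 * K s) \<le> g a * exp (- 2 * K a)"
    proof (rule DERIV_nonpos_imp_nonincreasing[OF True, where f = "\<lambda>t. g t * exp (- 2 * K t)"])
      fix t
      have "((\<lambda>t. g t * exp (- 2 * K t)) has_real_derivative
          (g' t - 2 * k t * g t) * exp (- 2 * K t)) (at t)"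
        by (auto intro!: derivative_eq_intros g K simp: algebra_simps)
      moreover have "(g' t - 2 * k t * g t) * exp (- 2 * K t) \<le> 0"
        using g'[of t] by (intro mult_nonpos_nonneg) auto
      ultimately show "\<exists>y. ((\<lambda>t. g t * exp (- 2 * K t)) has_real_derivative y) (at t) \<and> y \<le> 0"
        by blast
    qed
    then show ?thesis
      using \<open>D a = 0\<close> by (simp add: g_def mult_le_0_iff not_le)
  next
    case False
    have "g s * exp (2 * K s) \<le> g a * exp (2 * K a)"
    proof (rule DERIV_nonneg_imp_nondecreasing[where f = "\<lambda>t. g t * exp (2 * K t)"])
      fix t
      have "((\<lambda>t. g t * exp (2 * K t)) has_real_derivative
          (g' t + 2 * k t * g t) * exp (2 * K t)) (at t)"
        by (auto intro!: derivative_eq_intros g K simp: algebra_simps)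
      moreover have "(g' t + 2 * k t * g t) * exp (2 * K t) \<ge> 0"
        using g'[of t] by (intro mult_nonneg_nonneg) auto
      ultimately show "\<exists>y. ((\<lambda>t. g t * exp (2 * K t)) has_real_derivative y) (at t) \<and> y \<ge> 0"
        by blast
    qed (use False in simp)
    then show ?thesis
      using \<open>D a = 0\<close> by (simp add: g_def mult_le_0_iff not_le)
  qed
  then show ?thesis
    by (simp add: g_def)
qed

text \<open>
  Multiplying \<open>F\<close> by a fixed unit vector makes it a map of the space to itself, the form in which
  \<open>c1_implies_local_lipschitz\<close> turns a continuous derivative into local Lipschitz bounds; compactness
  makes the constant uniform.
\<close>
lemma C1_on_imp_lipschitz_on_compact:
  fixes F :: "'a::euclidean_space \<Rightarrow> real"
  assumes F: "C1_on U F" and "open U" "compact S" "S \<subseteq> U"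
  obtains L where "L-lipschitz_on S F"
proof -
  obtain D where D: "\<And>x. x \<in> U \<Longrightarrow> (F has_derivative blinfun_apply (D x)) (at x within U)"
      and contD: "continuous_on U D"
    using F by (auto simp: C1_on_def)
  obtain e :: 'a where e: "e \<in> Basis"
    using nonempty_Basis by blast
  have "local_lipschitz (UNIV::real set) U (\<lambda>t x. F x *\<^sub>R e)"
  proof (rule c1_implies_local_lipschitz[where f' = "\<lambda>(t, x). blinfun_scaleR_left e o\<^sub>L D x"])
    fix t :: real and x assume "x \<in> U"
    then have "(F has_derivative blinfun_apply (D x)) (at x)"
      using D at_within_open[OF _ \<open>open U\<close>] by metis
    then show "((\<lambda>x. F x *\<^sub>R e) has_derivative
        blinfun_apply (case (t, x) of (t, x) \<Rightarrow> blinfun_scaleR_left e o\<^sub>L D x)) (at x)"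
      by (auto intro!: derivative_eq_intros simp: blinfun_compose.rep_eq o_def)
  next
    have "continuous_on (UNIV \<times> U) (\<lambda>z::real \<times> 'a. D (snd z))"
      by (rule continuous_on_compose2[OF contD]) (auto intro!: continuous_intros)
    then show "continuous_on (UNIV \<times> U) (\<lambda>(t::real, x). blinfun_scaleR_left e o\<^sub>L D x)"
      unfolding case_prod_beta
      by (intro bounded_bilinear.continuous_on[OF bounded_bilinear_blinfun_compose] continuous_intros)
  qed (use \<open>open U\<close> in auto)
  then have "local_lipschitz {0::real} S (\<lambda>t x. F x *\<^sub>R e)"
    by (rule local_lipschitz_subset) (use \<open>S \<subseteq> U\<close> in auto)
  then obtain L where "L-lipschitz_on S (\<lambda>x. F x *\<^sub>R e)"
    using local_lipschitz_compact_implies_lipschitz[OF _ \<open>compact S\<close>, of "{0::real}"] by auto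
  then have "L-lipschitz_on S F"
    using e by (simp add: lipschitz_on_def dist_norm scaleR_diff_left[symmetric])
  then show ?thesis
    using that by blast
qed

lemma C1_sphere_imp_lipschitz:
  fixes H :: "'a::euclidean_space \<Rightarrow> real"
  assumes "C1_sphere H"
  obtains L where "L-lipschitz_on (sphere 0 1) H"
proof -
  obtain U F where UF: "open U" "sphere 0 1 \<subseteq> U" "C1_on U F" and eq: "\<And>x. x \<in> sphere 0 1 \<Longrightarrow> F x = H x"
    using assms unfolding C1_sphere_def by blast
  obtain L where "L-lipschitz_on (sphere 0 1) F"
    using C1_on_imp_lipschitz_on_compact[OF UF(3,1) compact_sphere UF(2)] .
  then have "L-lipschitz_on (sphere 0 1) H"
    by (rule lipschitz_on_transform) (simp add: eq)
  then show ?thesis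
    using that by blast
qed

section \<open>Oriented planes and the mean curvature of a cylinder\<close>

lemma has_vector_derivative_in_subspace:
  fixes \<gamma> :: "real \<Rightarrow> 'a::euclidean_space"
  assumes \<gamma>: "(\<gamma> has_vector_derivative d) (at s)" and P: "subspace P" "\<And>t. \<gamma> t \<in> P"
  shows "d \<in> P"
proof -
  have "q \<bullet> d = 0" if q: "q \<in> orthogonal_comp P" for q
  proof -
    have "((\<lambda>t. q \<bullet> \<gamma> t) has_vector_derivative q \<bullet> d) (at s)"
      using has_vector_derivative_inner[OF has_vector_derivative_const \<gamma>, of q] by simp
    moreover have "(\<lambda>t. q \<bullet> \<gamma> t) = (\<lambda>t. 0)"
    proof
      fix t
      have "\<gamma> t \<bullet> q = 0"
        using q P(2)[of t] by (simp add: orthogonal_comp_def orthogonal_def)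
      then show "q \<bullet> \<gamma> t = 0"
        by (simp only: inner_commute)
    qed
    ultimately have "((\<lambda>t. 0) has_vector_derivative q \<bullet> d) (at s)"
      by simp
    then show ?thesis
      using vector_derivative_unique_at[OF _ has_vector_derivative_const] by blast
  qed
  then have "d \<in> orthogonal_comp (orthogonal_comp P)"
    by (auto simp: orthogonal_comp_def orthogonal_def)
  then show ?thesis
    by (simp add: orthogonal_comp_self P(1))
qed

lemma subspace_cylinder_domain: "subspace (cylinder_domain P)"
  unfolding cylinder_domain_def by (intro subspace_Times subspace_UNIV subspace_orthogonal_comp)

lemma cylinder_has_derivative:
  assumes "(\<alpha> has_vector_derivative d) (at (fst x))"
  shows "(cylinder \<alpha> has_derivative (\<lambda>w. fst w *\<^sub>R d + snd w)) (at x within W)"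
proof -
  have "((\<lambda>x. \<alpha> (fst x)) has_derivative (\<lambda>w. fst w *\<^sub>R d)) (at x within W)"
    using has_derivative_compose[OF has_derivative_fst[OF has_derivative_ident]
        assms[unfolded has_vector_derivative_def]] .
  then have "((\<lambda>x. \<alpha> (fst x) + snd x) has_derivative (\<lambda>w. fst w *\<^sub>R d + snd w)) (at x within W)"
    by (intro has_derivative_add has_derivative_snd has_derivative_ident)
  then show ?thesis
    by (simp add: cylinder_def case_prod_beta')
qed

text \<open>
  The derivative of the cylinder at \<open>(s, p)\<close> depends on the point only through \<open>\<alpha>' s\<close>, and it is an
  affine function of \<open>\<alpha>' s\<close>.
\<close>
lemma C2_on_cylinder:
  assumes "C2_on UNIV \<alpha>"
  shows "C2_on W (cylinder \<alpha>)"
proof -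
  obtain \<alpha>' where \<alpha>': "\<And>s. (\<alpha> has_vector_derivative \<alpha>' s) (at s)" and C1: "C1_on UNIV \<alpha>'"
    using assms by (auto simp: C2_on_curve_iff)
  define D :: "real \<times> 'a \<Rightarrow> (real \<times> 'a) \<Rightarrow>\<^sub>L 'a"
    where "D x = (blinfun_scaleR_left (\<alpha>' (fst x)) o\<^sub>L Blinfun fst) + Blinfun snd" for x
  have "bounded_linear (\<lambda>y::'a. blinfun_scaleR_left y o\<^sub>L (Blinfun fst :: (real \<times> 'a) \<Rightarrow>\<^sub>L real))"
    using bounded_bilinear.bounded_linear_left[OF bounded_bilinear_blinfun_compose]
      bounded_linear_blinfun_scaleR_left by (rule bounded_linear_compose)
  note bl = C1_on_bounded_linear[OF this, of UNIV]
  have "C1_on W (\<lambda>x. \<alpha>' (fst x))"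
    by (rule C1_on_compose[OF C1 C1_on_bounded_linear[OF bounded_linear_fst] subset_UNIV])
  then have "C1_on W D"
    unfolding D_def by (intro C1_on_add_const) (rule C1_on_compose[OF bl _ subset_UNIV])
  moreover have "(cylinder \<alpha> has_derivative blinfun_apply (D x)) (at x within W)" for x
  proof -
    have "blinfun_apply (D x) = (\<lambda>w. fst w *\<^sub>R \<alpha>' (fst x) + snd w)"
      by (simp add: D_def fun_eq_iff plus_blinfun.rep_eq
          bounded_linear_Blinfun_apply[OF bounded_linear_fst] bounded_linear_Blinfun_apply[OF bounded_linear_snd])
    then show ?thesis
      using cylinder_has_derivative[OF \<alpha>'[of "fst x"]] by simp
  qed
  ultimately show ?thesis
    unfolding C2_on_def by (intro exI[of _ D]) simp
qed

locale oriented_plane =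
  fixes P :: "'a::euclidean_space set" and J :: "'a \<Rightarrow> 'a"
  assumes subspace_P: "subspace P" and dim_P: "dim P = 2" and quarter_turn: "quarter_turn P J"
begin

abbreviation W :: "(real \<times> 'a) set" where "W \<equiv> cylinder_domain P"

lemma linear_J: "linear J"
  using quarter_turn by (simp add: quarter_turn_def)

lemma J_in: "x \<in> P \<Longrightarrow> J x \<in> P"
  and norm_J: "x \<in> P \<Longrightarrow> norm (J x) = norm x"
  and inner_J: "x \<in> P \<Longrightarrow> J x \<bullet> x = 0"
  using quarter_turn by (auto simp: quarter_turn_def orthogonal_def)

text \<open>
  Polarizing the orthogonality of \<open>J y\<close> and \<open>y\<close> at \<open>y = x + J x\<close> shows that \<open>J (J x)\<close> has inner
  product \<open>- (norm x)\<^sup>2\<close> with \<open>x\<close>; as both have the same norm, this is the equality case of the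
  Cauchy-Schwarz inequality.
\<close>
lemma J_J:
  assumes x: "x \<in> P"
  shows "J (J x) = - x"
proof -
  have "J (x + J x) \<bullet> (x + J x) = 0"
    by (intro inner_J subspace_add subspace_P x J_in)
  then have "J (J x) \<bullet> x + (norm (J x))\<^sup>2 = 0"
    using inner_J[OF x] inner_J[OF J_in[OF x]]
    by (simp add: linear_add[OF linear_J] inner_add_left inner_add_right power2_norm_eq_inner)
  then have "J (J x) \<bullet> x = - (norm x)\<^sup>2"
    using norm_J[OF x] by simp
  moreover have "(J (J x) + x) \<bullet> (J (J x) + x) = (norm (J (J x)))\<^sup>2 + 2 * (J (J x) \<bullet> x) + (norm x)\<^sup>2"
    by (simp add: inner_add_left inner_add_right power2_norm_eq_inner inner_commute)
  ultimately have "(J (J x) + x) \<bullet> (J (J x) + x) = 0"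
    using norm_J[OF x] norm_J[OF J_in[OF x]] by simp
  then show ?thesis
    by (simp add: eq_neg_iff_add_eq_0)
qed

lemma inner_perp:
  assumes "x \<in> P" "q \<in> orthogonal_comp P"
  shows "x \<bullet> q = 0" "q \<bullet> x = 0"
  using assms by (auto simp: orthogonal_comp_def orthogonal_def inner_commute)

lemma in_P_if_perp:
  assumes "\<And>q. q \<in> orthogonal_comp P \<Longrightarrow> x \<bullet> q = 0"
  shows "x \<in> P"
proof -
  have "x \<in> orthogonal_comp (orthogonal_comp P)"
    using assms by (auto simp: orthogonal_comp_def[of "orthogonal_comp P"] orthogonal_def inner_commute)
  then show ?thesis
    by (simp add: orthogonal_comp_self subspace_P)
qed

lemma frame_decomposition:
  assumes x: "x \<in> P" "norm x = 1" and y: "y \<in> P"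
  shows "y = (y \<bullet> x) *\<^sub>R x + (y \<bullet> J x) *\<^sub>R J x"
proof -
  have unit: "x \<bullet> x = 1" "J x \<bullet> J x = 1" "J x \<bullet> x = 0" "x \<bullet> J x = 0"
    using x norm_J[OF x(1)] inner_J[OF x(1)] by (simp_all add: inner_commute flip: norm_eq_1)
  have ne: "x \<noteq> J x" "x \<noteq> 0" "J x \<noteq> 0"
    using unit by auto
  have "pairwise orthogonal {x, J x}"
    using unit by (auto simp: pairwise_def orthogonal_def)
  then have "independent {x, J x}"
    using ne by (intro pairwise_orthogonal_independent) auto
  then have "P \<subseteq> span {x, J x}"
    using x(1) J_in[OF x(1)] dim_P ne by (intro card_ge_dim_independent) auto
  then have "y \<in> span (insert x {J x})"
    using y by blast
  then obtain a where "y - a *\<^sub>R x \<in> span {J x}"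
    using span_breakdown_eq[of y x "{J x}"] by blast
  then obtain b where "y - a *\<^sub>R x = b *\<^sub>R J x"
    by (auto simp: span_singleton)
  then have ab: "y = a *\<^sub>R x + b *\<^sub>R J x"
    by (simp add: diff_eq_eq add.commute)
  have "y \<bullet> x = a" "y \<bullet> J x = b"
    using unit by (simp_all add: ab inner_add_left)
  then show ?thesis
    using ab by simp
qed

lemma full_decomposition:
  assumes x: "x \<in> P" "norm x = 1"
  obtains q where "q \<in> orthogonal_comp P" "z = (z \<bullet> x) *\<^sub>R x + (z \<bullet> J x) *\<^sub>R J x + q"
proof -
  have "z \<in> P + orthogonal_comp P"
    by (simp add: subspace_sum_orthogonal_comp subspace_P)
  then obtain y q where z: "z = y + q" "y \<in> P" "q \<in> orthogonal_comp P"
    by (auto elim: set_plus_elim)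
  have "z \<bullet> x = y \<bullet> x" "z \<bullet> J x = y \<bullet> J x"
    using inner_perp[OF x(1) z(3)] inner_perp[OF J_in[OF x(1)] z(3)] by (simp_all add: z(1) inner_add_left)
  then show ?thesis
    using that[OF z(3)] frame_decomposition[OF x z(2)] z(1) by simp
qed

lemma DIM_ge_2: "DIM('a) \<ge> 2"
  using dim_subset_UNIV[of P] dim_P by simp

lemma dim_W: "dim W + 1 = DIM('a)"
proof -
  have "dim (orthogonal_comp P) + dim P = DIM('a)"
    using dim_subspace_orthogonal_to_vectors[OF subspace_P subspace_UNIV]
    by (simp add: orthogonal_comp_def)
  moreover have "dim W = 1 + dim (orthogonal_comp P)"
    unfolding cylinder_domain_def
    by (subst dim_Times) (simp_all add: subspace_orthogonal_comp)
  ultimately show ?thesis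
    using dim_P by simp
qed

lemma in_W_iff: "w \<in> W \<longleftrightarrow> snd w \<in> orthogonal_comp P"
  by (cases w) (simp add: cylinder_domain_def)

lemma frechet_cylinder:
  assumes "(\<alpha> has_vector_derivative d) (at (fst x))" "x \<in> W" "w \<in> W"
  shows "frechet_derivative (cylinder \<alpha>) (at x within W) w = fst w *\<^sub>R d + snd w"
  by (rule frechet_derivative_within_subspace[OF cylinder_has_derivative[OF assms(1)]
        subspace_cylinder_domain assms(2,3)])

lemma frechet_gauss_map:
  assumes N: "(N has_vector_derivative N') (at (fst x))"
    and \<eta>: "\<And>s p. p \<in> orthogonal_comp P \<Longrightarrow> \<eta> (s, p) = N s" and "x \<in> W" "w \<in> W"
  shows "frechet_derivative \<eta> (at x within W) w = fst w *\<^sub>R N'"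
proof -
  have d: "((\<lambda>x. N (fst x)) has_derivative (\<lambda>w. fst w *\<^sub>R N')) (at x within W)"
    using has_derivative_compose[OF has_derivative_fst[OF has_derivative_ident]
        N[unfolded has_vector_derivative_def]] .
  have eq: "\<eta> y = N (fst y)" if "y \<in> W" for y
    using \<eta>[of "snd y" "fst y"] that by (simp add: in_W_iff)
  have "(\<eta> has_derivative (\<lambda>w. fst w *\<^sub>R N')) (at x within W)"
    by (rule has_derivative_transform[OF \<open>x \<in> W\<close> eq d])
  then show ?thesis
    by (rule frechet_derivative_within_subspace[OF _ subspace_cylinder_domain assms(3,4)])
qed

text \<open>
  The shape operator is \<open>c / \<rho>\<close> times the orthogonal projection to the line of \<open>\<tau>\<close>: it vanishes on
  the normal \<open>J \<tau>\<close> and along the rulings, and \<open>J (J \<tau>) = - \<tau>\<close> turns \<open>- \<eta>'\<close> into \<open>c \<tau>\<close>, while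
  the derivative of the cylinder in the same direction is \<open>\<rho> \<tau>\<close>.
\<close>
lemma mean_curvature_cylinder:
  assumes \<alpha>: "(\<alpha> has_vector_derivative \<rho> *\<^sub>R \<tau> s) (at s)" and "\<rho> \<noteq> 0"
    and \<tau>: "\<tau> s \<in> P" "norm (\<tau> s) = 1" "(\<tau> has_vector_derivative c *\<^sub>R J (\<tau> s)) (at s)"
    and \<eta>: "\<And>s p. p \<in> orthogonal_comp P \<Longrightarrow> \<eta> (s, p) = J (\<tau> s)"
    and p: "p \<in> orthogonal_comp P"
  shows "mean_curvature W (cylinder \<alpha>) \<eta> (s, p) = c / (\<rho> * real (DIM('a) - 1))"
proof -
  let ?T = "\<tau> s"
  define A where "A z = (c / \<rho> * (z \<bullet> ?T)) *\<^sub>R ?T" for z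
  have x: "(s, p) \<in> W"
    using p by (simp add: in_W_iff)
  have d\<psi>: "frechet_derivative (cylinder \<alpha>) (at (s, p) within W) w = fst w *\<^sub>R \<rho> *\<^sub>R ?T + snd w"
    if "w \<in> W" for w
    using frechet_cylinder[of \<alpha> _ "(s, p)", OF _ x that] \<alpha> by simp
  have "((\<lambda>s. J (\<tau> s)) has_vector_derivative - c *\<^sub>R ?T) (at s)"
    using bounded_linear.has_vector_derivative[OF linear_conv_bounded_linear[THEN iffD1, OF linear_J] \<tau>(3)]
    by (simp add: linear_scale[OF linear_J] J_J[OF \<tau>(1)])
  then have d\<eta>: "frechet_derivative \<eta> (at (s, p) within W) w = - (fst w * c) *\<^sub>R ?T" if "w \<in> W" for w
    using frechet_gauss_map[of "\<lambda>s. J (\<tau> s)" _ "(s, p)" \<eta>, OF _ \<eta> x that] by simp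
  have TT: "?T \<bullet> ?T = 1"
    using \<tau>(2) by (simp add: norm_eq_1)
  have "shape_operator W (cylinder \<alpha>) \<eta> (s, p) = A"
    unfolding shape_operator_def
  proof (rule the_equality, intro conjI ballI)
    show "linear A"
      unfolding A_def by (rule linearI) (simp_all add: algebra_simps)
    show "A (\<eta> (s, p)) = 0"
      by (simp add: \<eta>[OF p] A_def inner_J[OF \<tau>(1)])
    fix w assume w: "w \<in> W"
    have "snd w \<bullet> ?T = 0"
      using w inner_perp[OF \<tau>(1)] by (simp add: in_W_iff)
    then show "A (frechet_derivative (cylinder \<alpha>) (at (s, p) within W) w)
        = - frechet_derivative \<eta> (at (s, p) within W) w"
      using \<open>\<rho> \<noteq> 0\<close> TT by (simp add: d\<psi>[OF w] d\<eta>[OF w] A_def inner_add_left)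
  next
    fix B assume B: "linear B \<and> B (\<eta> (s, p)) = 0 \<and>
      (\<forall>w\<in>W. B (frechet_derivative (cylinder \<alpha>) (at (s, p) within W) w)
        = - frechet_derivative \<eta> (at (s, p) within W) w)"
    then have lin: "linear B" and BN: "B (J ?T) = 0"
      by (simp_all add: \<eta>[OF p])
    have Bd: "B (fst w *\<^sub>R \<rho> *\<^sub>R ?T + snd w) = (fst w * c) *\<^sub>R ?T" if "w \<in> W" for w
    proof -
      have "B (frechet_derivative (cylinder \<alpha>) (at (s, p) within W) w)
          = - frechet_derivative \<eta> (at (s, p) within W) w"
        using B that by blast
      then show ?thesis
        unfolding d\<psi>[OF that] d\<eta>[OF that] by simp
    qed
    have "B (\<rho> *\<^sub>R ?T) = c *\<^sub>R ?T"
      using Bd[of "(1, 0)"] by (simp add: in_W_iff subspace_0 subspace_orthogonal_comp)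
    then have "\<rho> *\<^sub>R B ?T = c *\<^sub>R ?T"
      by (simp add: linear_scale[OF lin])
    then have "(1 / \<rho>) *\<^sub>R \<rho> *\<^sub>R B ?T = (1 / \<rho>) *\<^sub>R c *\<^sub>R ?T"
      by simp
    then have BT: "B ?T = (c / \<rho>) *\<^sub>R ?T"
      using \<open>\<rho> \<noteq> 0\<close> by simp
    have Bq: "B q = 0" if "q \<in> orthogonal_comp P" for q
      using Bd[of "(0, q)"] that by (simp add: in_W_iff)
    show "B = A"
    proof
      fix z
      obtain q where q: "q \<in> orthogonal_comp P"
          and z: "z = (z \<bullet> ?T) *\<^sub>R ?T + (z \<bullet> J ?T) *\<^sub>R J ?T + q"
        using full_decomposition[OF \<tau>(1,2)] .
      have "B z = B ((z \<bullet> ?T) *\<^sub>R ?T + (z \<bullet> J ?T) *\<^sub>R J ?T + q)"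
        using z by (rule arg_cong)
      also have "\<dots> = (z \<bullet> ?T) *\<^sub>R B ?T"
        by (simp add: linear_add[OF lin] linear_scale[OF lin] BN Bq[OF q])
      also have "\<dots> = A z"
        by (simp add: BT A_def)
      finally show "B z = A z" .
    qed
  qed
  then have "(\<Sum>b\<in>Basis. shape_operator W (cylinder \<alpha>) \<eta> (s, p) b \<bullet> b)
      = (\<Sum>b\<in>Basis. c / \<rho> * ((?T \<bullet> b) * (?T \<bullet> b)))"
    by (simp add: A_def inner_commute mult_ac)
  also have "\<dots> = c / \<rho>"
    unfolding sum_distrib_left[symmetric] euclidean_inner[symmetric] using TT by simp
  finally have trace: "(\<Sum>b\<in>Basis. shape_operator W (cylinder \<alpha>) \<eta> (s, p) b \<bullet> b) = c / \<rho>" .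
  have "dim W = DIM('a) - 1"
    using dim_W by simp
  then show ?thesis
    unfolding mean_curvature_def trace by simp
qed

end

section \<open>Signed speed, arc length and completeness\<close>

lemma nonvanishing_constant_sign:
  fixes \<rho> :: "real \<Rightarrow> real"
  assumes "continuous_on UNIV \<rho>" "\<And>s. \<rho> s \<noteq> 0"
  obtains \<epsilon> where "\<bar>\<epsilon>\<bar> = 1" "\<And>s. \<bar>\<rho> s\<bar> = \<epsilon> * \<rho> s"
proof -
  have "continuous_on UNIV (\<lambda>s. sgn (\<rho> s))"
    using assms by (intro continuous_on_sgn) auto
  moreover have "finite (range (\<lambda>s. sgn (\<rho> s)))"
    by (rule finite_subset[of _ "{- 1, 0, 1}"]) (auto simp: sgn_if)
  ultimately have "(\<lambda>s. sgn (\<rho> s)) constant_on UNIV"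
    by (intro continuous_finite_range_constant) auto
  then obtain \<epsilon> where \<epsilon>: "\<And>s. sgn (\<rho> s) = \<epsilon>"
    unfolding constant_on_def by auto
  have "\<bar>\<epsilon>\<bar> = 1"
    using \<epsilon>[of 0] assms(2)[of 0] by (auto simp: sgn_if split: if_splits)
  moreover have "\<bar>\<rho> s\<bar> = \<epsilon> * \<rho> s" for s
    using abs_sgn[of "\<rho> s"] by (simp add: \<epsilon>)
  ultimately show ?thesis
    using that by blast
qed

text \<open>
  As \<open>\<rho>\<close> has a constant sign \<open>\<epsilon>\<close>, the integral of \<open>\<bar>\<rho>\<bar>\<close> is \<open>\<epsilon>\<close> times an increment of \<open>\<phi>\<close>.
\<close>
lemma arc_distance_eq:
  assumes \<alpha>: "\<And>s. (\<alpha> has_vector_derivative \<rho> s *\<^sub>R \<tau> s) (at s)" and "\<And>s. norm (\<tau> s) = 1"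
    and \<rho>: "continuous_on UNIV \<rho>" "\<And>s. \<rho> s \<noteq> 0"
    and \<phi>: "\<And>s. (\<phi> has_real_derivative \<rho> s) (at s)"
  shows "arc_distance \<alpha> s t = \<bar>\<phi> s - \<phi> t\<bar>"
proof -
  obtain \<epsilon> where \<epsilon>: "\<bar>\<epsilon>\<bar> = 1" "\<And>s. \<bar>\<rho> s\<bar> = \<epsilon> * \<rho> s"
    by (rule nonvanishing_constant_sign[OF \<rho>]) blast
  define a where "a = min s t"
  define b where "b = max s t"
  have speed: "norm (vector_derivative \<alpha> (at u)) = \<bar>\<rho> u\<bar>" for u
    using vector_derivative_at[OF \<alpha>[of u]] assms(2)[of u] by simp
  have "((\<lambda>u. \<bar>\<rho> u\<bar>) has_integral (\<epsilon> * \<phi> b - \<epsilon> * \<phi> a)) {a..b}"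
  proof (rule fundamental_theorem_of_calculus)
    show "a \<le> b"
      by (simp add: a_def b_def)
    fix u
    have "((\<lambda>u. \<epsilon> * \<phi> u) has_real_derivative \<bar>\<rho> u\<bar>) (at u within {a..b})"
      unfolding \<epsilon>(2) by (intro DERIV_cmult DERIV_subset[OF \<phi>]) simp
    then show "((\<lambda>u. \<epsilon> * \<phi> u) has_vector_derivative \<bar>\<rho> u\<bar>) (at u within {a..b})"
      by (simp add: has_real_derivative_iff_has_vector_derivative)
  qed
  then have int: "integral {a..b} (\<lambda>u. \<bar>\<rho> u\<bar>) = \<epsilon> * (\<phi> b - \<phi> a)" and ge: "0 \<le> \<epsilon> * (\<phi> b - \<phi> a)"
    by (auto simp: integral_unique right_diff_distrib dest: has_integral_nonneg)
  then have "integral {a..b} (\<lambda>u. \<bar>\<rho> u\<bar>) = \<bar>\<epsilon> * (\<phi> b - \<phi> a)\<bar>"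
    by simp
  also have "\<dots> = \<bar>\<phi> s - \<phi> t\<bar>"
    by (simp add: abs_mult \<epsilon>(1) a_def b_def min_def max_def abs_minus_commute)
  finally show ?thesis
    by (simp add: arc_distance_def speed a_def b_def)
qed

lemma inj_if_derivative_nonzero:
  fixes \<phi> :: "real \<Rightarrow> real"
  assumes \<phi>: "\<And>s. (\<phi> has_real_derivative \<rho> s) (at s)" and "\<And>s. \<rho> s \<noteq> 0"
  shows "inj \<phi>"
proof -
  have "\<phi> s \<noteq> \<phi> t" if st: "s < t" for s t
  proof -
    obtain z where "\<phi> t - \<phi> s = (t - s) * \<rho> z"
      using MVT2[OF st, of \<phi> \<rho>] \<phi> by blast
    then show ?thesis
      using st assms(2)[of z] by auto
  qed
  then show ?thesis
    by (intro linorder_injI)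
qed

text \<open>
  Up to renaming of points, this metric space is the subset \<open>range h\<close> of the real line, and a
  subset of a complete space is complete exactly if it is closed.
\<close>
lemma mcomplete_inj_pullback_iff:
  fixes h :: "real \<Rightarrow> real"
  assumes "inj h"
  shows "Metric_space.mcomplete UNIV (\<lambda>s t. \<bar>h s - h t\<bar>) \<longleftrightarrow> closed (range h)"
proof -
  interpret M: Metric_space UNIV "\<lambda>s t. \<bar>h s - h t\<bar>"
    by unfold_locales (use \<open>inj h\<close> in \<open>auto dest: injD\<close>)
  have lim: "limitin M.mtopology \<sigma> x sequentially \<longleftrightarrow> (\<lambda>n. h (\<sigma> n)) \<longlonglongrightarrow> h x" for \<sigma> x
    by (simp add: M.limit_metric_sequentially lim_sequentially dist_real_def)
  have Cau: "M.MCauchy \<sigma> \<longleftrightarrow> Cauchy (\<lambda>n. h (\<sigma> n))" for \<sigma>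
    by (auto simp: M.MCauchy_def Cauchy_def dist_real_def)
  show ?thesis
  proof
    assume "M.mcomplete"
    show "closed (range h)"
      unfolding closed_sequential_limits
    proof (intro allI impI, elim conjE)
      fix y l assume "\<forall>n. y n \<in> range h" and l: "y \<longlonglongrightarrow> l"
      then have "\<exists>\<sigma>. \<forall>n. y n = h (\<sigma> n)"
        by (intro choice) (auto simp: image_iff)
      then obtain \<sigma> where y: "y = (\<lambda>n. h (\<sigma> n))"
        by blast
      have "M.MCauchy \<sigma>"
        unfolding Cau using l unfolding y by (rule LIMSEQ_imp_Cauchy)
      then obtain x where "y \<longlonglongrightarrow> h x"
        using \<open>M.mcomplete\<close> unfolding M.mcomplete_def lim y by blast
      then show "l \<in> range h"
        using l LIMSEQ_unique by blast
    qed
  next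
    assume closed: "closed (range h)"
    show "M.mcomplete"
      unfolding M.mcomplete_def lim Cau
    proof (intro allI impI)
      fix \<sigma> assume "Cauchy (\<lambda>n. h (\<sigma> n))"
      then obtain l where l: "(\<lambda>n. h (\<sigma> n)) \<longlonglongrightarrow> l"
        using Cauchy_convergent convergentD by blast
      then have "l \<in> range h"
        using closed_sequentially[OF closed _ l] by simp
      then show "\<exists>x. (\<lambda>n. h (\<sigma> n)) \<longlonglongrightarrow> h x"
        using l by blast
    qed
  qed
qed

text \<open>
  By completeness the range of \<open>\<phi>\<close> is closed, and as \<open>\<phi>\<close> is continuous and injective it is open;
  the line is connected.
\<close>
lemma arc_length_bij:
  assumes \<alpha>: "complete_regular_curve \<alpha>"
    and "\<And>s. (\<alpha> has_vector_derivative \<rho> s *\<^sub>R \<tau> s) (at s)" "\<And>s. norm (\<tau> s) = 1"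
    and \<rho>: "continuous_on UNIV \<rho>" "\<And>s. \<rho> s \<noteq> 0"
    and \<phi>: "\<And>s. (\<phi> has_real_derivative \<rho> s) (at s)"
  shows "bij \<phi>"
proof -
  have inj: "inj \<phi>"
    using inj_if_derivative_nonzero[OF \<phi> \<rho>(2)] .
  have "arc_distance \<alpha> = (\<lambda>s t. \<bar>\<phi> s - \<phi> t\<bar>)"
    using arc_distance_eq[OF assms(2-6)] by (intro ext)
  then have "closed (range \<phi>)"
    using \<alpha> mcomplete_inj_pullback_iff[OF inj] by (simp add: complete_regular_curve_def)
  moreover have "open (range \<phi>)"
  proof -
    have "continuous_on UNIV \<phi>"
      using \<phi> by (intro DERIV_continuous_on) auto
    then show ?thesis
      using injective_eq_1d_open_map_UNIV[of UNIV \<phi>] inj by simp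
  qed
  ultimately have "range \<phi> = UNIV"
    using clopen[of "range \<phi>"] by auto
  then show ?thesis
    using inj by (simp add: bij_def)
qed

section \<open>The curvature equation\<close>

context oriented_plane
begin

text \<open>
  The Frenet equations of a curve in \<open>P\<close> whose cylinder, oriented by the normal \<open>J \<tau>\<close>, has mean
  curvature \<open>H (J \<tau>)\<close>. The speed \<open>\<rho>\<close> is signed because \<open>\<tau>\<close> is fixed by the Gauss map and not
  by the direction in which the curve is traversed.
\<close>
definition H_frame :: "('a \<Rightarrow> real) \<Rightarrow> (real \<Rightarrow> 'a) \<Rightarrow> (real \<times> 'a \<Rightarrow> 'a) \<Rightarrow> (real \<Rightarrow> real) \<Rightarrow> (real \<Rightarrow> 'a) \<Rightarrow> bool" where
  "H_frame H \<alpha> \<eta> \<rho> \<tau> \<longleftrightarrow> C1_on UNIV \<rho> \<and>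
     (\<forall>s. \<rho> s \<noteq> 0 \<and> \<tau> s \<in> P \<and> norm (\<tau> s) = 1 \<and>
        (\<alpha> has_vector_derivative \<rho> s *\<^sub>R \<tau> s) (at s) \<and>
        (\<tau> has_vector_derivative (\<rho> s * (real (DIM('a) - 1) * H (J (\<tau> s)))) *\<^sub>R J (\<tau> s)) (at s) \<and>
        (\<forall>p\<in>orthogonal_comp P. \<eta> (s, p) = J (\<tau> s)))"

lemma H_frameD:
  assumes "H_frame H \<alpha> \<eta> \<rho> \<tau>"
  shows "C1_on UNIV \<rho>" "\<rho> s \<noteq> 0" "\<tau> s \<in> P" "norm (\<tau> s) = 1"
    "(\<alpha> has_vector_derivative \<rho> s *\<^sub>R \<tau> s) (at s)"
    "(\<tau> has_vector_derivative (\<rho> s * (real (DIM('a) - 1) * H (J (\<tau> s)))) *\<^sub>R J (\<tau> s)) (at s)"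
    "p \<in> orthogonal_comp P \<Longrightarrow> \<eta> (s, p) = J (\<tau> s)"
  using assms unfolding H_frame_def by simp_all

lemma DIM_minus_1_pos: "0 < real (DIM('a) - 1)"
  using DIM_ge_2 by simp

lemma C1_on_J: "C1_on S J"
  by (intro C1_on_bounded_linear linear_conv_bounded_linear[THEN iffD1] linear_J)

text \<open>
  Regularity is gained from the equation: its right-hand side is continuous, so \<open>\<tau>\<close> is of class
  $C^1$, and then \<open>\<alpha>' = \<rho> \<tau>\<close> shows that \<open>\<alpha>\<close> is of class $C^2$.
\<close>
lemma H_frame_imp_H_hypersurface:
  assumes fr: "H_frame H \<alpha> \<eta> \<rho> \<tau>" and H: "continuous_on (sphere 0 1) H"
  shows "H_hypersurface H W (cylinder \<alpha>) \<eta>" "C2_on UNIV \<alpha>"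
proof -
  note fr = H_frameD[OF fr]
  have Jsphere: "J (\<tau> s) \<in> sphere 0 1" for s
    using norm_J[OF fr(3)[of s]] fr(4)[of s] by simp
  have cont\<tau>: "continuous_on UNIV \<tau>"
    by (intro continuous_at_imp_continuous_on ballI has_vector_derivative_continuous[OF fr(6)])
  have contJ\<tau>: "continuous_on UNIV (\<lambda>s. J (\<tau> s))"
    by (rule continuous_on_compose2[OF linear_continuous_on cont\<tau> subset_UNIV])
      (use linear_J linear_conv_bounded_linear in blast)
  have contH: "continuous_on UNIV (\<lambda>s. H (J (\<tau> s)))"
    by (rule continuous_on_compose2[OF H contJ\<tau>]) (use Jsphere in blast)
  have cont\<rho>: "continuous_on UNIV \<rho>"
    using fr(1) by (rule C1_on_imp_continuous_on)
  have C1\<tau>: "C1_on UNIV \<tau>"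
    unfolding C1_on_curve_iff
    by (intro exI[of _ "\<lambda>s. (\<rho> s * (real (DIM('a) - 1) * H (J (\<tau> s)))) *\<^sub>R J (\<tau> s)"] conjI allI fr(6)
        continuous_intros contH cont\<rho> contJ\<tau>)
  show C2: "C2_on UNIV \<alpha>"
    unfolding C2_on_curve_iff
    by (intro exI[of _ "\<lambda>s. \<rho> s *\<^sub>R \<tau> s"] conjI allI fr(5) C1_on_curve_scaleR fr(1) C1\<tau>)
  have C1N: "C1_on W (\<lambda>x. J (\<tau> (fst x)))"
    by (rule C1_on_compose[OF C1_on_J _ subset_UNIV],
        rule C1_on_compose[OF C1\<tau> C1_on_bounded_linear[OF bounded_linear_fst] subset_UNIV])
  have \<eta>_eq: "\<eta> x = J (\<tau> (fst x))" if "x \<in> W" for x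
    using fr(7)[of "snd x" "fst x"] that by (simp add: in_W_iff)
  have C1\<eta>: "C1_on W \<eta>"
  proof -
    obtain D where D: "\<And>x. x \<in> W \<Longrightarrow> ((\<lambda>x. J (\<tau> (fst x))) has_derivative blinfun_apply (D x)) (at x within W)"
        and cD: "continuous_on W D"
      using C1N unfolding C1_on_def by blast
    have "(\<eta> has_derivative blinfun_apply (D x)) (at x within W)" if "x \<in> W" for x
      by (rule has_derivative_transform[OF that \<eta>_eq D[OF that]])
    then show ?thesis
      unfolding C1_on_def using cD by blast
  qed
  have d\<psi>: "frechet_derivative (cylinder \<alpha>) (at x within W) w
      = fst w *\<^sub>R \<rho> (fst x) *\<^sub>R \<tau> (fst x) + snd w" if "x \<in> W" "w \<in> W" for x w
    by (rule frechet_cylinder[OF fr(5) that])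
  have ip: "\<tau> s \<bullet> snd w = 0" "J (\<tau> s) \<bullet> snd w = 0" if "w \<in> W" for s w
    using that inner_perp(1)[OF fr(3)] inner_perp(1)[OF J_in[OF fr(3)]] by (simp_all add: in_W_iff)
  have "inj_on (frechet_derivative (cylinder \<alpha>) (at x within W)) W" if x: "x \<in> W" for x
  proof (rule inj_onI)
    fix w z assume w: "w \<in> W" and z: "z \<in> W"
      and "frechet_derivative (cylinder \<alpha>) (at x within W) w = frechet_derivative (cylinder \<alpha>) (at x within W) z"
    then have eq: "fst w *\<^sub>R \<rho> (fst x) *\<^sub>R \<tau> (fst x) + snd w = fst z *\<^sub>R \<rho> (fst x) *\<^sub>R \<tau> (fst x) + snd z"
      by (simp only: d\<psi>[OF x w] d\<psi>[OF x z])
    from arg_cong[OF this, of "\<lambda>y. \<tau> (fst x) \<bullet> y"]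
    have "fst w * \<rho> (fst x) = fst z * \<rho> (fst x)"
      using fr(4)[of "fst x"] by (auto simp: inner_add_right ip[OF w] ip[OF z])
    then have "fst w = fst z"
      using fr(2) by simp
    then show "w = z"
      using eq by (simp add: prod_eq_iff)
  qed
  moreover have "orthogonal (\<eta> x) u" if x: "x \<in> W" and u: "u \<in> tangent_space W (cylinder \<alpha>) x" for x u
  proof -
    obtain w where w: "w \<in> W" and "u = frechet_derivative (cylinder \<alpha>) (at x within W) w"
      using u unfolding tangent_space_def by blast
    then have "u = fst w *\<^sub>R \<rho> (fst x) *\<^sub>R \<tau> (fst x) + snd w"
      by (simp only: d\<psi>[OF x w])
    then show ?thesis
      using inner_J[OF fr(3)] by (simp add: orthogonal_def \<eta>_eq[OF x] inner_add_right ip[OF w])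
  qed
  moreover have "norm (\<eta> x) = 1" if "x \<in> W" for x
    using Jsphere[of "fst x"] by (simp add: \<eta>_eq[OF that])
  ultimately have "immersed_oriented_hypersurface W (cylinder \<alpha>) \<eta>"
    unfolding immersed_oriented_hypersurface_def
    using C2_on_cylinder[OF C2] C1\<eta> dim_W subspace_cylinder_domain by blast
  moreover have "mean_curvature W (cylinder \<alpha>) \<eta> x = H (\<eta> x)" if x: "x \<in> W" for x
  proof -
    have p: "snd x \<in> orthogonal_comp P"
      using x by (simp add: in_W_iff)
    have "mean_curvature W (cylinder \<alpha>) \<eta> (fst x, snd x)
        = \<rho> (fst x) * (real (DIM('a) - 1) * H (J (\<tau> (fst x)))) / (\<rho> (fst x) * real (DIM('a) - 1))"
      by (rule mean_curvature_cylinder[of \<alpha> "\<rho> (fst x)" \<tau>]) (use fr p in simp_all)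
    also have "\<dots> = H (J (\<tau> (fst x)))"
      using fr(2)[of "fst x"] DIM_minus_1_pos by simp
    finally show ?thesis
      by (simp add: \<eta>_eq[OF x])
  qed
  ultimately show "H_hypersurface H W (cylinder \<alpha>) \<eta>"
    unfolding H_hypersurface_def by blast
qed

text \<open>
  The Gauss map is orthogonal to the rulings, hence lies in \<open>P\<close>, and the frame is read off from it as
  \<open>\<tau> = - J \<eta>\<close> along the curve. As the plane \<open>P\<close> has only two unit normals to the curve at each point,
  \<open>\<eta>\<close> is constant along each ruling by continuity. The curvature equation is then
  \<open>mean_curvature_cylinder\<close>.
\<close>
lemma complete_flat_H_hypersurface_imp_H_frame:
  assumes "complete_flat_H_hypersurface H P \<alpha> \<eta>"
  obtains \<rho> \<tau> where "H_frame H \<alpha> \<eta> \<rho> \<tau>"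
proof -
  have reg: "complete_regular_curve \<alpha>" and in_P: "\<And>s. \<alpha> s \<in> P"
    and imm: "immersed_oriented_hypersurface W (cylinder \<alpha>) \<eta>"
    and mc: "\<And>x. x \<in> W \<Longrightarrow> mean_curvature W (cylinder \<alpha>) \<eta> x = H (\<eta> x)"
    using assms unfolding complete_flat_H_hypersurface_def H_hypersurface_def by auto
  obtain \<alpha>' where \<alpha>': "\<And>s. (\<alpha> has_vector_derivative \<alpha>' s) (at s)" and C1\<alpha>': "C1_on UNIV \<alpha>'"
    using reg unfolding complete_regular_curve_def C2_on_curve_iff by blast
  have \<alpha>'_nz: "\<alpha>' s \<noteq> 0" for s
  proof -
    have "vector_derivative \<alpha> (at s) \<noteq> 0"
      using reg unfolding complete_regular_curve_def by blast
    then show ?thesis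
      by (simp only: vector_derivative_at[OF \<alpha>'[of s]] simp_thms)
  qed
  have \<alpha>'_P: "\<alpha>' s \<in> P" for s
    using has_vector_derivative_in_subspace[OF \<alpha>' subspace_P in_P] .
  have C1\<eta>: "C1_on W \<eta>" and unit: "\<And>x. x \<in> W \<Longrightarrow> norm (\<eta> x) = 1"
    and orth: "\<And>x u. x \<in> W \<Longrightarrow> u \<in> tangent_space W (cylinder \<alpha>) x \<Longrightarrow> \<eta> x \<bullet> u = 0"
    using imm unfolding immersed_oriented_hypersurface_def orthogonal_def by auto
  have orth': "\<eta> x \<bullet> (fst w *\<^sub>R \<alpha>' (fst x) + snd w) = 0" if "x \<in> W" "w \<in> W" for x w
  proof (rule orth[OF that(1)])
    show "fst w *\<^sub>R \<alpha>' (fst x) + snd w \<in> tangent_space W (cylinder \<alpha>) x"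
      unfolding tangent_space_def using frechet_cylinder[OF \<alpha>' that] that(2) by (metis image_eqI)
  qed
  have zero: "(0::'a) \<in> orthogonal_comp P"
    by (simp add: subspace_0 subspace_orthogonal_comp)
  have \<eta>\<alpha>: "\<eta> (s, p) \<bullet> \<alpha>' s = 0" if "p \<in> orthogonal_comp P" for s p
    using orth'[of "(s, p)" "(1, 0)"] that zero by (simp add: in_W_iff)
  have \<eta>_P: "\<eta> (s, p) \<in> P" if "p \<in> orthogonal_comp P" for s p
    by (rule in_P_if_perp) (use orth'[of "(s, p)" "(0, q)" for q] that in \<open>simp add: in_W_iff\<close>)
  have \<eta>_unit: "norm (\<eta> (s, p)) = 1" if "p \<in> orthogonal_comp P" for s p
    using unit[of "(s, p)"] that by (simp add: in_W_iff)
  define N where "N s = \<eta> (s, 0)" for s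
  define \<tau> where "\<tau> s = - J (N s)" for s
  define \<rho> where "\<rho> s = \<alpha>' s \<bullet> \<tau> s" for s
  have N_P: "N s \<in> P" and N_unit: "norm (N s) = 1" for s
    by (simp_all add: N_def \<eta>_P \<eta>_unit zero)
  have \<tau>_P: "\<tau> s \<in> P" for s
    unfolding \<tau>_def by (intro subspace_neg subspace_P J_in N_P)
  have \<tau>_unit: "norm (\<tau> s) = 1" for s
    using norm_J[OF N_P] N_unit by (simp add: \<tau>_def)
  have J\<tau>: "J (\<tau> s) = N s" for s
    by (simp add: \<tau>_def linear_neg[OF linear_J] J_J[OF N_P])
  have \<alpha>'_eq: "\<alpha>' s = \<rho> s *\<^sub>R \<tau> s" for s
    using frame_decomposition[OF \<tau>_P \<tau>_unit \<alpha>'_P, of s s] \<eta>\<alpha>[OF zero, of s]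
    by (simp add: J\<tau> \<rho>_def N_def inner_commute)
  have \<rho>_nz: "\<rho> s \<noteq> 0" for s
    using \<alpha>'_nz[of s] \<alpha>'_eq[of s] by auto
  have C1N: "C1_on UNIV N"
  proof -
    have "bounded_linear (\<lambda>s::real. (s, 0::'a))"
      by (intro bounded_linear_Pair bounded_linear_ident bounded_linear_zero)
    then show ?thesis
      unfolding N_def
      by (intro C1_on_compose[OF C1\<eta> C1_on_bounded_linear]) (auto simp: in_W_iff zero)
  qed
  have C1\<tau>: "C1_on UNIV \<tau>"
    unfolding \<tau>_def
    by (rule C1_on_compose[OF C1_on_bounded_linear[OF bounded_linear_minus[OF bounded_linear_ident]] _ subset_UNIV],
        rule C1_on_compose[OF C1_on_J C1N subset_UNIV])
  have C1\<rho>: "C1_on UNIV \<rho>"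
    unfolding \<rho>_def by (intro C1_on_curve_inner C1\<alpha>' C1\<tau>)
  obtain \<tau>' where \<tau>': "\<And>s. (\<tau> has_vector_derivative \<tau>' s) (at s)"
    using C1\<tau> unfolding C1_on_curve_iff by blast
  have \<tau>'_P: "\<tau>' s \<in> P" for s
    using has_vector_derivative_in_subspace[OF \<tau>' subspace_P \<tau>_P] .
  have "\<tau>' s \<bullet> \<tau> s = 0" for s
  proof -
    have "(\<lambda>s. \<tau> s \<bullet> \<tau> s) = (\<lambda>s. 1)"
      using \<tau>_unit by (simp add: norm_eq_1)
    then have "((\<lambda>s. 1) has_vector_derivative \<tau> s \<bullet> \<tau>' s + \<tau>' s \<bullet> \<tau> s) (at s)"
      using has_vector_derivative_inner[OF \<tau>' \<tau>', of s] by simp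
    from vector_derivative_unique_at[OF this has_vector_derivative_const] show ?thesis
      by (simp add: inner_commute)
  qed
  then have \<tau>'_eq: "\<tau>' s = (\<tau>' s \<bullet> J (\<tau> s)) *\<^sub>R J (\<tau> s)" for s
    using frame_decomposition[OF \<tau>_P \<tau>_unit \<tau>'_P, of s s] by simp
  have \<eta>_eq: "\<eta> (s, p) = J (\<tau> s)" if p: "p \<in> orthogonal_comp P" for s p
  proof -
    have dichotomy: "\<eta> (s, q) = (\<eta> (s, q) \<bullet> N s) *\<^sub>R N s \<and> \<bar>\<eta> (s, q) \<bullet> N s\<bar> = 1"
      if q: "q \<in> orthogonal_comp P" for q
    proof -
      have "\<rho> s * (\<eta> (s, q) \<bullet> \<tau> s) = 0"
        using \<eta>\<alpha>[OF q, of s] by (simp add: \<alpha>'_eq)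
      then have eq: "\<eta> (s, q) = (\<eta> (s, q) \<bullet> N s) *\<^sub>R N s"
        using frame_decomposition[OF \<tau>_P \<tau>_unit \<eta>_P[OF q], of s s] \<rho>_nz[of s] by (simp add: J\<tau>)
      have "norm (\<eta> (s, q)) = norm ((\<eta> (s, q) \<bullet> N s) *\<^sub>R N s)"
        using eq by (rule arg_cong)
      then have "\<bar>\<eta> (s, q) \<bullet> N s\<bar> = 1"
        unfolding norm_scaleR N_unit \<eta>_unit[OF q] by simp
      with eq show ?thesis
        by blast
    qed
    have "continuous_on W \<eta>"
      using C1\<eta> by (rule C1_on_imp_continuous_on)
    then have "continuous_on (orthogonal_comp P) (\<lambda>q. \<eta> (s, q))"
      by (rule continuous_on_compose2) (auto intro!: continuous_intros simp: in_W_iff)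
    then have "continuous_on (orthogonal_comp P) (\<lambda>q. \<eta> (s, q) \<bullet> N s)"
      by (intro continuous_intros)
    moreover have "finite ((\<lambda>q. \<eta> (s, q) \<bullet> N s) ` orthogonal_comp P)"
      by (rule finite_subset[of _ "{- 1, 1}"]) (use dichotomy in \<open>fastforce simp: abs_if split: if_splits\<close>)+
    ultimately have "(\<lambda>q. \<eta> (s, q) \<bullet> N s) constant_on orthogonal_comp P"
      by (intro continuous_finite_range_constant convex_connected subspace_imp_convex
          subspace_orthogonal_comp)
    then have "\<eta> (s, p) \<bullet> N s = \<eta> (s, 0) \<bullet> N s"
      using p zero unfolding constant_on_def by metis
    also have "\<dots> = 1"
      using N_unit[of s] by (simp add: N_def norm_eq_1)
    finally show ?thesis
      using dichotomy[OF p] by (simp add: J\<tau>)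
  qed
  have curvature: "\<tau>' s \<bullet> J (\<tau> s) = \<rho> s * (real (DIM('a) - 1) * H (J (\<tau> s)))" for s
  proof -
    have "mean_curvature W (cylinder \<alpha>) \<eta> (s, 0) = (\<tau>' s \<bullet> J (\<tau> s)) / (\<rho> s * real (DIM('a) - 1))"
    proof (rule mean_curvature_cylinder[of \<alpha> "\<rho> s" \<tau> s])
      show "(\<alpha> has_vector_derivative \<rho> s *\<^sub>R \<tau> s) (at s)"
        using \<alpha>'[of s] by (simp only: \<alpha>'_eq)
      show "(\<tau> has_vector_derivative (\<tau>' s \<bullet> J (\<tau> s)) *\<^sub>R J (\<tau> s)) (at s)"
        using \<tau>'[of s] \<tau>'_eq[of s] by simp
    qed (use \<rho>_nz \<tau>_P \<tau>_unit \<eta>_eq zero in simp_all)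
    moreover have "mean_curvature W (cylinder \<alpha>) \<eta> (s, 0) = H (J (\<tau> s))"
      using mc[of "(s, 0)"] \<eta>_eq[OF zero, of s] by (simp add: in_W_iff zero)
    ultimately show ?thesis
      using \<rho>_nz[of s] DIM_minus_1_pos by (simp add: field_simps)
  qed
  have "H_frame H \<alpha> \<eta> \<rho> \<tau>"
    unfolding H_frame_def
  proof (intro conjI allI ballI C1\<rho> \<rho>_nz \<tau>_P \<tau>_unit \<eta>_eq)
    show "(\<alpha> has_vector_derivative \<rho> s *\<^sub>R \<tau> s) (at s)" for s
      using \<alpha>'[of s] by (simp only: \<alpha>'_eq)
    show "(\<tau> has_vector_derivative (\<rho> s * (real (DIM('a) - 1) * H (J (\<tau> s)))) *\<^sub>R J (\<tau> s)) (at s)" for s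
      using \<tau>'[of s] \<tau>'_eq[of s] by (simp add: curvature)
  qed
  then show ?thesis
    using that by blast
qed

section \<open>Uniqueness and existence of the frame\<close>

text \<open>
  \<open>H\<close> is bounded and Lipschitz on the sphere, and \<open>J\<close> is an isometry of \<open>P\<close>.
\<close>
lemma curvature_field_lipschitz:
  assumes H: "L-lipschitz_on (sphere 0 1) H"
  obtains K where "K \<ge> 0" "\<And>x y. \<lbrakk>x \<in> P; norm x = 1; y \<in> P; norm y = 1\<rbrakk> \<Longrightarrow>
    norm ((a * H (J x)) *\<^sub>R J x - (a * H (J y)) *\<^sub>R J y) \<le> K * norm (x - y)"
proof -
  have "compact (H ` sphere 0 1)"
    by (intro compact_continuous_image lipschitz_on_continuous_on[OF H] compact_sphere)
  then obtain M where "\<And>y. y \<in> H ` sphere 0 1 \<Longrightarrow> norm y \<le> M"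
    using compact_imp_bounded[of "H ` sphere 0 1"] unfolding bounded_iff by blast
  then have M: "\<bar>H x\<bar> \<le> M" if "norm x = 1" for x
    using that by simp
  have L: "L \<ge> 0"
    using lipschitz_on_nonneg[OF H] .
  have "norm ((a * H (J x)) *\<^sub>R J x - (a * H (J y)) *\<^sub>R J y) \<le> \<bar>a\<bar> * (\<bar>M\<bar> + L) * norm (x - y)"
    if x: "x \<in> P" "norm x = 1" and y: "y \<in> P" "norm y = 1" for x y
  proof -
    have unit: "norm (J x) = 1" "norm (J y) = 1"
      using norm_J x y by simp_all
    have J_diff: "norm (J x - J y) = norm (x - y)"
      using norm_J[OF subspace_diff[OF subspace_P x(1) y(1)]] by (simp add: linear_diff[OF linear_J])
    have "(a * H (J x)) *\<^sub>R J x - (a * H (J y)) *\<^sub>R J y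
        = (a * H (J x)) *\<^sub>R (J x - J y) + (a * (H (J x) - H (J y))) *\<^sub>R J y"
      by (simp add: algebra_simps)
    then have "norm ((a * H (J x)) *\<^sub>R J x - (a * H (J y)) *\<^sub>R J y)
        \<le> norm ((a * H (J x)) *\<^sub>R (J x - J y)) + norm ((a * (H (J x) - H (J y))) *\<^sub>R J y)"
      by (simp only: norm_triangle_ineq)
    also have "\<dots> = \<bar>a\<bar> * (\<bar>H (J x)\<bar> * norm (x - y) + \<bar>H (J x) - H (J y)\<bar>)"
      by (simp only: norm_scaleR J_diff unit abs_mult distrib_left mult.assoc mult_1_right)
    also have "\<dots> \<le> \<bar>a\<bar> * (\<bar>M\<bar> * norm (x - y) + L * norm (x - y))"
    proof (intro mult_left_mono add_mono mult_right_mono)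
      show "\<bar>H (J x)\<bar> \<le> \<bar>M\<bar>"
        using M[OF unit(1)] by simp
      show "\<bar>H (J x) - H (J y)\<bar> \<le> L * norm (x - y)"
        using lipschitz_onD[OF H, of "J x" "J y"] unit by (simp add: dist_norm J_diff)
    qed auto
    finally show ?thesis
      by (simp add: algebra_simps)
  qed
  then show ?thesis
    using that[of "\<bar>a\<bar> * (\<bar>M\<bar> + L)"] L by simp
qed

text \<open>
  Reparametrizing the unit speed solution by the signed arc length \<open>\<phi>\<close> of \<open>\<beta>\<close> turns its frame into a
  second solution of the equation for \<open>\<tau>\<close>, with the same value at \<open>s\<^sub>0\<close>. The difference of the two
  frames therefore vanishes by Gronwall's inequality with the rate \<open>K * \<bar>\<rho> s\<bar>\<close>.
\<close>
lemma H_frames_equal_up_to_translation: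
  assumes \<alpha>: "H_frame H \<alpha> \<eta> (\<lambda>_. 1) \<sigma>" and \<beta>: "H_frame H \<beta> \<zeta> \<rho> \<tau>"
    and "complete_regular_curve \<beta>" and H: "L-lipschitz_on (sphere 0 1) H" and start: "\<tau> s\<^sub>0 = \<sigma> 0"
  shows "equal_up_to_translation P \<alpha> \<eta> \<beta> \<zeta>"
proof -
  note \<alpha> = H_frameD[OF \<alpha>] and \<beta> = H_frameD[OF \<beta>]
  define n where "n = real (DIM('a) - 1)"
  define X where "X w = (n * H (J w)) *\<^sub>R J w" for w
  have \<sigma>': "(\<sigma> has_vector_derivative X (\<sigma> t)) (at t)" for t
    using \<alpha>(6)[of t] by (simp add: X_def n_def)
  have \<tau>': "(\<tau> has_vector_derivative \<rho> s *\<^sub>R X (\<tau> s)) (at s)" for s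
    using \<beta>(6)[of s] by (simp add: X_def n_def)
  have cont\<rho>: "continuous_on UNIV \<rho>"
    using \<beta>(1) by (rule C1_on_imp_continuous_on)
  obtain \<phi> where "\<And>s. (\<phi> has_vector_derivative \<rho> s) (at s)" and \<phi>0: "\<phi> s\<^sub>0 = 0"
    using antiderivative_exists[OF cont\<rho>] by blast
  then have \<phi>v: "\<And>s. (\<phi> has_vector_derivative \<rho> s) (at s)" and \<phi>: "\<And>s. (\<phi> has_real_derivative \<rho> s) (at s)"
    by (simp_all add: has_real_derivative_iff_has_vector_derivative)
  have chain: "((\<lambda>s. g (\<phi> s)) has_vector_derivative \<rho> s *\<^sub>R g' (\<phi> s)) (at s)"
    if "\<And>t. (g has_vector_derivative g' t) (at t)" for g :: "real \<Rightarrow> 'a" and g' s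
    using vector_diff_chain_at[OF \<phi>v that] by (simp add: o_def)
  obtain \<epsilon> where \<epsilon>: "\<bar>\<epsilon>\<bar> = 1" "\<And>s. \<bar>\<rho> s\<bar> = \<epsilon> * \<rho> s"
    by (rule nonvanishing_constant_sign[OF cont\<rho> \<beta>(2)]) blast
  obtain K where K: "K \<ge> 0" "\<And>x y. \<lbrakk>x \<in> P; norm x = 1; y \<in> P; norm y = 1\<rbrakk> \<Longrightarrow>
      norm (X x - X y) \<le> K * norm (x - y)"
    unfolding X_def by (rule curvature_field_lipschitz[OF H, of n]) blast
  have same: "\<tau> s = \<sigma> (\<phi> s)" for s
  proof -
    have "\<tau> s - \<sigma> (\<phi> s) = 0"
    proof (rule linearly_bounded_derivative_imp_zero[where a = s\<^sub>0
            and D = "\<lambda>s. \<tau> s - \<sigma> (\<phi> s)" and K = "\<lambda>s. (K * \<epsilon>) * \<phi> s" and k = "\<lambda>s. (K * \<epsilon>) * \<rho> s"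
            and D' = "\<lambda>s. \<rho> s *\<^sub>R X (\<tau> s) - \<rho> s *\<^sub>R X (\<sigma> (\<phi> s))"])
      show "((\<lambda>s. \<tau> s - \<sigma> (\<phi> s)) has_vector_derivative \<rho> s *\<^sub>R X (\<tau> s) - \<rho> s *\<^sub>R X (\<sigma> (\<phi> s))) (at s)" for s
        by (intro has_vector_derivative_diff \<tau>' chain \<sigma>')
      show "((\<lambda>s. (K * \<epsilon>) * \<phi> s) has_real_derivative (K * \<epsilon>) * \<rho> s) (at s)" for s
        by (intro DERIV_cmult \<phi>)
      show "norm (\<rho> s *\<^sub>R X (\<tau> s) - \<rho> s *\<^sub>R X (\<sigma> (\<phi> s))) \<le> (K * \<epsilon>) * \<rho> s * norm (\<tau> s - \<sigma> (\<phi> s))" for s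
      proof -
        have "norm (\<rho> s *\<^sub>R X (\<tau> s) - \<rho> s *\<^sub>R X (\<sigma> (\<phi> s))) = \<bar>\<rho> s\<bar> * norm (X (\<tau> s) - X (\<sigma> (\<phi> s)))"
          unfolding scaleR_diff_right[symmetric] norm_scaleR ..
        also have "\<dots> \<le> \<bar>\<rho> s\<bar> * (K * norm (\<tau> s - \<sigma> (\<phi> s)))"
          by (intro mult_left_mono K(2) \<alpha> \<beta> abs_ge_zero)
        finally show ?thesis
          unfolding \<epsilon>(2) by (simp only: mult_ac)
      qed
      show "\<tau> s\<^sub>0 - \<sigma> (\<phi> s\<^sub>0) = 0"
        by (simp add: \<phi>0 start)
    qed
    then show ?thesis
      by simp
  qed
  have \<alpha>': "(\<alpha> has_vector_derivative \<sigma> t) (at t)" for t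
    using \<alpha>(5)[of t] by simp
  have \<alpha>\<phi>: "((\<lambda>s. \<alpha> (\<phi> s)) has_vector_derivative \<rho> s *\<^sub>R \<tau> s) (at s)" for s
    unfolding same by (rule chain[OF \<alpha>'])
  obtain c where c: "\<And>s. \<beta> s = \<alpha> (\<phi> s) + c"
    by (rule curves_differ_by_constant[OF \<beta>(5) \<alpha>\<phi>]) blast
  show ?thesis
    unfolding equal_up_to_translation_def
  proof (intro exI[of _ \<phi>] exI[of _ c] conjI allI ballI)
    show "bij \<phi>"
      using arc_length_bij[OF assms(3) \<beta>(5) \<beta>(4) cont\<rho> \<beta>(2) \<phi>] .
    show "C2_on UNIV \<phi>"
      unfolding C2_on_curve_iff by (intro exI[of _ \<rho>] conjI allI \<phi>v \<beta>(1))
    show "vector_derivative \<phi> (at s) \<noteq> 0" for s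
      unfolding vector_derivative_at[OF \<phi>v] by (rule \<beta>(2))
    show "\<beta> s = \<alpha> (\<phi> s) + c" for s
      by (rule c)
    show "\<zeta> (s, p) = \<eta> (\<phi> s, p)" if "p \<in> orthogonal_comp P" for s p
      by (simp add: \<alpha>(7)[OF that] \<beta>(7)[OF that] same)
  qed
qed

text \<open>
  Writing \<open>\<sigma> = e \<circ> \<theta>\<close>, with \<open>e\<close> the unit speed parametrization of the unit circle of \<open>P\<close> that
  starts at \<open>v\<close>, reduces the equation for the frame to \<open>\<theta>' = n H(J (e \<theta>))\<close>. The curve is built
  from antiderivatives of its coordinates in the basis \<open>v, J v\<close>, so that it stays in \<open>P\<close>.
\<close>
lemma H_frame_exists:
  assumes H: "L-lipschitz_on (sphere 0 1) H" and v: "v \<in> P" "norm v = 1"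
  obtains \<alpha> \<eta> \<sigma> where "H_frame H \<alpha> \<eta> (\<lambda>_. 1) \<sigma>" "\<sigma> 0 = v" "complete_regular_curve \<alpha>" "range \<alpha> \<subseteq> P"
proof -
  define n where "n = real (DIM('a) - 1)"
  define e where "e a = cos a *\<^sub>R v + sin a *\<^sub>R J v" for a
  have e_P: "e a \<in> P" for a
    unfolding e_def by (intro subspace_add subspace_scale subspace_P v J_in)
  have "v \<bullet> v = 1" "J v \<bullet> J v = 1" "J v \<bullet> v = 0" "v \<bullet> J v = 0"
    using v norm_J[OF v(1)] inner_J[OF v(1)] by (simp_all add: inner_commute flip: norm_eq_1)
  then have "e a \<bullet> e a = (cos a)\<^sup>2 + (sin a)\<^sup>2" for a
    by (simp add: e_def inner_add_left inner_add_right power2_eq_square)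
  then have e_unit: "norm (e a) = 1" for a
    by (simp add: norm_eq_1)
  have Je: "J (e a) = - sin a *\<^sub>R v + cos a *\<^sub>R J v" for a
    by (simp add: e_def linear_add[OF linear_J] linear_scale[OF linear_J] J_J[OF v(1)])
  have e': "(e has_vector_derivative J (e a)) (at a)" for a
    unfolding e_def[abs_def] Je[unfolded e_def] has_vector_derivative_def
    by (auto intro!: derivative_eq_intros simp: algebra_simps)
  have e_lip: "norm (e a - e b) \<le> \<bar>a - b\<bar>" for a b
  proof -
    have "norm (e a - e b) \<le> 1 * norm (a - b)"
    proof (rule differentiable_bound[of UNIV e])
      show "(e has_derivative (\<lambda>h. h *\<^sub>R J (e a))) (at a within UNIV)" for a
        using e'[of a] by (simp add: has_vector_derivative_def)
      show "onorm (\<lambda>h. h *\<^sub>R J (e a)) \<le> 1" for a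
        by (rule onorm_le) (simp add: norm_J[OF e_P] e_unit)
    qed auto
    then show ?thesis
      by simp
  qed
  define f where "f a = n * H (J (e a))" for a
  have "(n * L)-lipschitz_on UNIV f"
  proof (rule lipschitz_onI)
    fix a b :: real
    have "norm (J (e a) - J (e b)) = norm (e a - e b)"
      using norm_J[OF subspace_diff[OF subspace_P e_P e_P]] by (simp add: linear_diff[OF linear_J])
    then have "\<bar>H (J (e a)) - H (J (e b))\<bar> \<le> L * norm (e a - e b)"
      using lipschitz_onD[OF H, of "J (e a)" "J (e b)"] norm_J[OF e_P] e_unit
      by (simp add: dist_norm)
    also have "\<dots> \<le> L * \<bar>a - b\<bar>"
      by (intro mult_left_mono e_lip lipschitz_on_nonneg[OF H])
    finally have "n * \<bar>H (J (e a)) - H (J (e b))\<bar> \<le> n * (L * \<bar>a - b\<bar>)"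
      by (intro mult_left_mono) (simp_all add: n_def)
    moreover have "dist (f a) (f b) = n * \<bar>H (J (e a)) - H (J (e b))\<bar>"
      unfolding f_def dist_real_def right_diff_distrib[symmetric] abs_mult by (simp add: n_def)
    ultimately show "dist (f a) (f b) \<le> n * L * dist a b"
      by (simp add: dist_real_def mult.assoc)
  qed (simp add: n_def lipschitz_on_nonneg[OF H])
  then obtain \<theta> where \<theta>': "\<And>s. (\<theta> has_vector_derivative f (\<theta> s)) (at s)" and \<theta>0: "\<theta> 0 = 0"
    using global_autonomous_ode_solution[of "n * L" f 0] by blast
  have cont\<theta>: "continuous_on UNIV \<theta>"
    by (intro continuous_at_imp_continuous_on ballI has_vector_derivative_continuous[OF \<theta>'])
  define \<sigma> where "\<sigma> s = e (\<theta> s)" for s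
  have \<sigma>': "(\<sigma> has_vector_derivative f (\<theta> s) *\<^sub>R J (\<sigma> s)) (at s)" for s
    using vector_diff_chain_at[OF \<theta>' e', of s] by (simp add: o_def \<sigma>_def[abs_def])
  have "continuous_on UNIV (\<lambda>s. cos (\<theta> s))" "continuous_on UNIV (\<lambda>s. sin (\<theta> s))"
    by (intro continuous_intros cont\<theta>)+
  then obtain x y where x: "\<And>s. (x has_vector_derivative cos (\<theta> s)) (at s)"
      and y: "\<And>s. (y has_vector_derivative sin (\<theta> s)) (at s)"
    using antiderivative_exists by (metis (no_types, lifting))
  define \<alpha> where "\<alpha> s = x s *\<^sub>R v + y s *\<^sub>R J v" for s
  have \<alpha>': "(\<alpha> has_vector_derivative \<sigma> s) (at s)" for s
  proof -
    have "((\<lambda>s. x s *\<^sub>R v) has_vector_derivative cos (\<theta> s) *\<^sub>R v) (at s)"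
      by (rule bounded_linear.has_vector_derivative[OF bounded_linear_scaleR_left x])
    moreover have "((\<lambda>s. y s *\<^sub>R J v) has_vector_derivative sin (\<theta> s) *\<^sub>R J v) (at s)"
      by (rule bounded_linear.has_vector_derivative[OF bounded_linear_scaleR_left y])
    ultimately show ?thesis
      unfolding \<alpha>_def[abs_def] \<sigma>_def e_def by (rule has_vector_derivative_add)
  qed
  define \<eta> :: "real \<times> 'a \<Rightarrow> 'a" where "\<eta> z = J (\<sigma> (fst z))" for z
  have "continuous_on UNIV (\<lambda>s::real. 0::real)"
    by simp
  then have "C1_on UNIV (\<lambda>_::real. 1::real)"
    unfolding C1_on_curve_iff by (intro exI[of _ "\<lambda>_. 0"]) simp
  then have frame: "H_frame H \<alpha> \<eta> (\<lambda>_. 1) \<sigma>"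
    unfolding H_frame_def
    using \<alpha>' \<sigma>' by (simp add: \<eta>_def \<sigma>_def e_P e_unit f_def n_def)
  moreover have "\<sigma> 0 = v"
    by (simp add: \<sigma>_def \<theta>0 e_def)
  moreover have "complete_regular_curve \<alpha>"
    unfolding complete_regular_curve_def
  proof (intro conjI allI)
    show "C2_on UNIV \<alpha>"
      using H_frame_imp_H_hypersurface(2)[OF frame lipschitz_on_continuous_on[OF H]] .
    have "\<sigma> s \<noteq> 0" for s
      using e_unit[of "\<theta> s"] unfolding \<sigma>_def by (metis norm_zero zero_neq_one)
    then show "vector_derivative \<alpha> (at s) \<noteq> 0" for s
      unfolding vector_derivative_at[OF \<alpha>'] .
    have "arc_distance \<alpha> s t = \<bar>s - t\<bar>" for s t
      by (rule arc_distance_eq[of \<alpha> "\<lambda>_. 1" \<sigma>]) (use \<alpha>' in \<open>simp_all add: \<sigma>_def e_unit\<close>)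
    then have "arc_distance \<alpha> = (\<lambda>s t. \<bar>s - t\<bar>)"
      by (intro ext)
    then show "Metric_space.mcomplete UNIV (arc_distance \<alpha>)"
      using mcomplete_inj_pullback_iff[of "\<lambda>s. s"] by simp
  qed
  moreover have "range \<alpha> \<subseteq> P"
    unfolding \<alpha>_def by (auto intro!: subspace_add subspace_scale subspace_P v J_in)
  ultimately show ?thesis
    using that by blast
qed

lemma H_frame_imp_tangent:
  assumes frame: "H_frame H \<alpha> \<eta> (\<lambda>_. 1) \<sigma>" and "complete_regular_curve \<alpha>" "range \<alpha> \<subseteq> P"
    and H: "continuous_on (sphere 0 1) H"
  shows "tangent_flat_H_hypersurface H P J (\<sigma> 0) \<alpha> \<eta>"
  unfolding tangent_flat_H_hypersurface_def
proof
  note fr = H_frameD[OF frame]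
  show "complete_flat_H_hypersurface H P \<alpha> \<eta>"
    unfolding complete_flat_H_hypersurface_def
    using assms H_frame_imp_H_hypersurface(1)[OF frame H] subspace_P dim_P by blast
  have zero: "(0::'a) \<in> orthogonal_comp P"
    by (simp add: subspace_0 subspace_orthogonal_comp)
  have in_W: "(0, 0) \<in> W" "(1, 0) \<in> W"
    by (simp_all add: in_W_iff zero)
  have "frechet_derivative (cylinder \<alpha>) (at (0, 0) within W) (1, 0) = \<sigma> 0"
    using frechet_cylinder[of \<alpha> _ "(0, 0)", OF _ in_W] fr(5)[of 0] by simp
  then have "\<sigma> 0 \<in> tangent_space W (cylinder \<alpha>) (0, 0)"
    unfolding tangent_space_def using in_W(2) by force
  then show "\<exists>x\<in>W. \<sigma> 0 \<in> tangent_space W (cylinder \<alpha>) x \<and> \<eta> x = J (\<sigma> 0)"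
    using fr(7)[OF zero, of 0] in_W(1) by blast
qed

end

theorem proposition2p12:
  fixes H :: "'a::euclidean_space \<Rightarrow> real"
    and P :: "'a set" and J :: "'a \<Rightarrow> 'a"
  assumes "C1_sphere H"
    and "subspace P" and "dim P = 2" and "quarter_turn P J"
  shows "\<exists>(\<alpha> :: 'a \<Rightarrow> real \<Rightarrow> 'a) (\<eta> :: 'a \<Rightarrow> real \<times> 'a \<Rightarrow> 'a).
     (\<forall>v \<in> P \<inter> sphere 0 1.
        tangent_flat_H_hypersurface H P J v (\<alpha> v) (\<eta> v) \<and>
        (\<forall>\<beta> \<zeta>. tangent_flat_H_hypersurface H P J v \<beta> \<zeta> \<longrightarrow>
           equal_up_to_translation P (\<alpha> v) (\<eta> v) \<beta> \<zeta>)) \<and>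
     (\<forall>\<beta> \<zeta>. complete_flat_H_hypersurface H P \<beta> \<zeta> \<longrightarrow>
        (\<exists>v \<in> P \<inter> sphere 0 1. equal_up_to_translation P (\<alpha> v) (\<eta> v) \<beta> \<zeta>))"
proof -
  interpret oriented_plane P J
    by unfold_locales (fact assms)+
  obtain L where H: "L-lipschitz_on (sphere 0 1) H"
    using C1_sphere_imp_lipschitz[OF assms(1)] .
  \<comment> \<open>A pair of a curve and a Gauss map, bundled so that a single choice over \<open>v\<close> suffices.\<close>
  define good where "good v A \<longleftrightarrow> (\<exists>\<sigma>. H_frame H (fst A) (snd A) (\<lambda>_. 1) \<sigma> \<and> \<sigma> 0 = v \<and>
    complete_regular_curve (fst A) \<and> range (fst A) \<subseteq> P)" for v and A :: "(real \<Rightarrow> 'a) \<times> (real \<times> 'a \<Rightarrow> 'a)"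
  have "\<exists>A. good v A" if v: "v \<in> P \<inter> sphere 0 1" for v
  proof -
    have "v \<in> P" "norm v = 1"
      using v by simp_all
    from H_frame_exists[OF H this] obtain \<alpha> \<eta> \<sigma> where "H_frame H \<alpha> \<eta> (\<lambda>_. 1) \<sigma>" "\<sigma> 0 = v"
        "complete_regular_curve \<alpha>" "range \<alpha> \<subseteq> P"
      by metis
    then have "good v (\<alpha>, \<eta>)"
      unfolding good_def fst_conv snd_conv by blast
    then show ?thesis ..
  qed
  then obtain A where A: "\<And>v. v \<in> P \<inter> sphere 0 1 \<Longrightarrow> good v (A v)"
    using bchoice[of "P \<inter> sphere 0 1" good] by blast
  have unique: "equal_up_to_translation P (fst (A v)) (snd (A v)) \<beta> \<zeta>"
    if v: "v \<in> P \<inter> sphere 0 1" and "H_frame H \<beta> \<zeta> \<rho> \<tau>" "complete_regular_curve \<beta>" "\<tau> s = v" for v \<beta> \<zeta> \<rho> \<tau> s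
  proof -
    obtain \<sigma> where "H_frame H (fst (A v)) (snd (A v)) (\<lambda>_. 1) \<sigma>" "\<sigma> 0 = v"
      using A[OF v] unfolding good_def by blast
    then show ?thesis
      using H_frames_equal_up_to_translation[OF _ that(2,3) H] that(4) by blast
  qed
  show ?thesis
  proof (intro exI[of _ "\<lambda>v. fst (A v)"] exI[of _ "\<lambda>v. snd (A v)"] conjI ballI allI impI)
    fix v assume v: "v \<in> P \<inter> sphere 0 1"
    show "tangent_flat_H_hypersurface H P J v (fst (A v)) (snd (A v))"
      using A[OF v] H_frame_imp_tangent[OF _ _ _ lipschitz_on_continuous_on[OF H]]
      unfolding good_def by blast
    fix \<beta> \<zeta> assume "tangent_flat_H_hypersurface H P J v \<beta> \<zeta>"
    then obtain s p where flat: "complete_flat_H_hypersurface H P \<beta> \<zeta>" and "(s, p) \<in> W" "\<zeta> (s, p) = J v"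
      unfolding tangent_flat_H_hypersurface_def by (metis surj_pair)
    obtain \<rho> \<tau> where fr: "H_frame H \<beta> \<zeta> \<rho> \<tau>"
      using complete_flat_H_hypersurface_imp_H_frame[OF flat] .
    have "J (\<tau> s) = J v"
      using H_frameD(7)[OF fr, of p s] \<open>(s, p) \<in> W\<close> \<open>\<zeta> (s, p) = J v\<close> by (simp add: in_W_iff)
    then have "\<tau> s = v"
      using J_J[OF H_frameD(3)[OF fr]] J_J[of v] v by (metis IntD1 neg_equal_iff_equal)
    moreover have "complete_regular_curve \<beta>"
      using flat unfolding complete_flat_H_hypersurface_def by blast
    ultimately show "equal_up_to_translation P (fst (A v)) (snd (A v)) \<beta> \<zeta>"
      using unique[OF v fr] by blast
  next
    fix \<beta> \<zeta> assume flat: "complete_flat_H_hypersurface H P \<beta> \<zeta>"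
    obtain \<rho> \<tau> where fr: "H_frame H \<beta> \<zeta> \<rho> \<tau>"
      using complete_flat_H_hypersurface_imp_H_frame[OF flat] .
    have "\<tau> 0 \<in> P \<inter> sphere 0 1"
      using H_frameD(3,4)[OF fr, of 0] by simp
    moreover have "complete_regular_curve \<beta>"
      using flat unfolding complete_flat_H_hypersurface_def by blast
    ultimately show "\<exists>v\<in>P \<inter> sphere 0 1. equal_up_to_translation P (fst (A v)) (snd (A v)) \<beta> \<zeta>"
      using unique[OF _ fr] by blast
  qed
qed

end
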